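(* Let $V$ be a real reflexive Banach space, $X$ a real Hilbert space, $\gamma : V\to X$ a compact linear operator, and $J:X\to\mathbb{R}$ a locally Lipschitz functional with generalized directional derivative $J^0$ and generalized gradient $\partial J$. Suppose that: (a) the operator $\mathcal{A}:V\to V^*$ is continuous and strongly monotone with constant $c_{\mathcal A}>0$, i.e. $(\mathcal{A}(v)-\mathcal{A}(w))(v-w)\ge c_{\mathcal A}\|v-w\|_V^2$ for all $v,w\in V$; (b) there is $c_J>0$ with $J^0(y_1;y_2-y_1)+J^0(y_2;y_1-y_2)\le c_J\|y_1-y_2\|_X^2$ for all $y_1,y_2\in X$; (c) there is $d_J>0$ with $\|\zeta\|_{X^*}\le d_J(1+\|z\|_X)$ for all $z\in X$ and $\zeta\in\partial J(z)$; (d) $c_J\|\gamma\|_{V\to X}^2<c_{\mathcal A}$. Let $F,F_n:V\to\mathbb{R}\cup\{+\infty\}$ $(n\in\mathbb{N})$ be convex lower semicontinuous proper functions such that for some $d_0\ge 0$ $$F_n(v)\ge -d_0(1+\|v\|)\qquad \forall n\in\mathbb{N},\ v\in V,$$ and let $F_n$ converge to $F$ in the Mosco sense. Then $\mathcal{S}(F_n)\to\mathcal{S}(F)$ strongly in $V$ as $n\to\infty$.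
   Context: For a locally Lipschitz $J:X\to\mathbb{R}$ the (Clarke) generalized directional derivative is $J^0(x;z):=\limsup_{y\to x,\,t\downarrow 0}\frac{J(y+tz)-J(y)}{t}$, and the generalized gradient is $\partial J(x)=\{\xi\in X^*: J^0(x;z)\ge\langle\xi,z\rangle\ \forall z\in X\}$. For a convex lower semicontinuous proper $F:V\to\mathbb{R}\cup\{+\infty\}$, put $\mathrm{dom}\,F:=\{v\in V:F(v)<+\infty\}$. $\mathcal{S}(F):=\hat v$ denotes the unique solution $\hat v\in\mathrm{dom}\,F$ of the extended real-valued hemivariational inequality $$\mathcal{A}(\hat v)(v-\hat v)+J^0(\gamma\hat v;\gamma v-\gamma\hat v)+F(v)-F(\hat v)\ge 0\qquad\forall v\in V$$ (under the stated assumptions on $\mathcal A,\gamma,J$ this inequality is uniquely solvable). Mosco convergence of $F_n$ to $F$ means: (M1) if $v_n\in V$ converge weakly to $v$, then $F(v)\le\liminf_{n\to\infty}F_n(v_n)$; (M2) for any $v\in V$ there exist $v_n\in V$ converging strongly to $v$ with $F(v)=\lim_{n\to\infty}F_n(v_n)$. *)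

theory Defs
  imports "HOL-Analysis.Analysis"
begin

text \<open>Dual spaces are types \<open>'a \<Rightarrow>\<^sub>L real\<close> with the operator norm.  Functionals
  \<open>V \<rightarrow> \<real> \<union> {+\<infinity>}\<close> are \<open>ereal\<close>-valued functions; \<open>proper_fun\<close> excludes the value \<open>-\<infinity>\<close>.\<close>

text \<open>Surjectivity of the canonical embedding into the bidual.  The dummy argument selects
  the type.\<close>

definition reflexive_space :: "'v::real_normed_vector itself \<Rightarrow> bool" where
  "reflexive_space _ \<longleftrightarrow>
     (\<forall>\<phi> :: ('v \<Rightarrow>\<^sub>L real) \<Rightarrow>\<^sub>L real. \<exists>v::'v. \<forall>f. blinfun_apply \<phi> f = blinfun_apply f v)"

definition weakly_converges :: "(nat \<Rightarrow> 'v::real_normed_vector) \<Rightarrow> 'v \<Rightarrow> bool" where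
  "weakly_converges u v \<longleftrightarrow>
     (\<forall>f :: 'v \<Rightarrow>\<^sub>L real. (\<lambda>n. blinfun_apply f (u n)) \<longlonglongrightarrow> blinfun_apply f v)"

definition compact_operator :: "('v::real_normed_vector \<Rightarrow>\<^sub>L 'x::real_normed_vector) \<Rightarrow> bool" where
  "compact_operator T \<longleftrightarrow> (\<forall>B. bounded B \<longrightarrow> compact (closure (blinfun_apply T ` B)))"

definition locally_lipschitz :: "('x::metric_space \<Rightarrow> real) \<Rightarrow> bool" where
  "locally_lipschitz J \<longleftrightarrow> (\<forall>x. \<exists>r>0. \<exists>L. L-lipschitz_on (ball x r) J)"

text \<open>The upper limit is taken in \<open>ereal\<close>, so that it always exists; it is finite when
  \<open>J\<close> is locally Lipschitz.\<close>

definition gen_dir_deriv :: "('x::real_normed_vector \<Rightarrow> real) \<Rightarrow> 'x \<Rightarrow> 'x \<Rightarrow> ereal" where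
  "gen_dir_deriv J x z =
     Limsup (nhds x \<times>\<^sub>F at_right 0) (\<lambda>(y, t). ereal ((J (y + t *\<^sub>R z) - J y) / t))"

definition gen_gradient :: "('x::real_normed_vector \<Rightarrow> real) \<Rightarrow> 'x \<Rightarrow> ('x \<Rightarrow>\<^sub>L real) set" where
  "gen_gradient J x = {\<xi>. \<forall>z. ereal (blinfun_apply \<xi> z) \<le> gen_dir_deriv J x z}"

definition strongly_monotone :: "real \<Rightarrow> ('v::real_normed_vector \<Rightarrow> 'v \<Rightarrow>\<^sub>L real) \<Rightarrow> bool" where
  "strongly_monotone c A \<longleftrightarrow>
     (\<forall>v w. blinfun_apply (A v - A w) (v - w) \<ge> c * (norm (v - w))\<^sup>2)"

definition domF :: "('v \<Rightarrow> ereal) \<Rightarrow> 'v set" where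
  "domF F = {v. F v < \<infinity>}"

definition proper_fun :: "('v \<Rightarrow> ereal) \<Rightarrow> bool" where
  "proper_fun F \<longleftrightarrow> (\<forall>v. F v \<noteq> -\<infinity>) \<and> domF F \<noteq> {}"

definition convex_fun :: "('v::real_vector \<Rightarrow> ereal) \<Rightarrow> bool" where
  "convex_fun F \<longleftrightarrow> (\<forall>v w. \<forall>t\<in>{0..1}.
     F ((1 - t) *\<^sub>R v + t *\<^sub>R w) \<le> ereal (1 - t) * F v + ereal t * F w)"

definition lsc_fun :: "('v::topological_space \<Rightarrow> ereal) \<Rightarrow> bool" where
  "lsc_fun F \<longleftrightarrow> (\<forall>v. F v \<le> Liminf (nhds v) F)"

definition mosco_converges ::
    "(nat \<Rightarrow> 'v::real_normed_vector \<Rightarrow> ereal) \<Rightarrow> ('v \<Rightarrow> ereal) \<Rightarrow> bool" where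
  "mosco_converges Fs F \<longleftrightarrow>
     (\<forall>u v. weakly_converges u v \<longrightarrow> F v \<le> liminf (\<lambda>n. Fs n (u n))) \<and>
     (\<forall>v. \<exists>u. u \<longlonglongrightarrow> v \<and> (\<lambda>n. Fs n (u n)) \<longlonglongrightarrow> F v)"

text \<open>Since a solution lies in \<open>domF F\<close>, the subtraction below is never \<open>\<infinity> - \<infinity>\<close>
  for proper \<open>F\<close>.\<close>

definition hvi_solution ::
    "('v::real_normed_vector \<Rightarrow> 'v \<Rightarrow>\<^sub>L real) \<Rightarrow> ('v \<Rightarrow>\<^sub>L 'x::real_normed_vector) \<Rightarrow>
     ('x \<Rightarrow> real) \<Rightarrow> ('v \<Rightarrow> ereal) \<Rightarrow> 'v \<Rightarrow> bool" where
  "hvi_solution A \<gamma> J F u \<longleftrightarrow> u \<in> domF F \<and>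
     (\<forall>v. ereal (blinfun_apply (A u) (v - u))
          + gen_dir_deriv J (blinfun_apply \<gamma> u) (blinfun_apply \<gamma> v - blinfun_apply \<gamma> u)
          + F v - F u \<ge> 0)"

definition hvi_sol ::
    "('v::real_normed_vector \<Rightarrow> 'v \<Rightarrow>\<^sub>L real) \<Rightarrow> ('v \<Rightarrow>\<^sub>L 'x::real_normed_vector) \<Rightarrow>
     ('x \<Rightarrow> real) \<Rightarrow> ('v \<Rightarrow> ereal) \<Rightarrow> 'v" where
  "hvi_sol A \<gamma> J F = (THE u. hvi_solution A \<gamma> J F u)"

end

theory Submission
  imports Defs
begin

text \<open>
  Put \<open>\<Phi> u v = \<langle>A u, v - u\<rangle> + J\<^sup>0(\<gamma> u; \<gamma> (v - u))\<close>.  A point \<open>u\<close> of \<open>domF F\<close> solves the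
  inequality for \<open>F\<close> iff \<open>F u \<le> \<Phi> u v + F v\<close> for all \<open>v\<close> in \<open>domF F\<close>, and strong monotonicity of
  \<open>A\<close>, relaxed monotonicity of \<open>J\<close> and the smallness condition together give
  \<open>\<Phi> u v + \<Phi> v u \<le> - (c\<^sub>A - c\<^sub>J \<parallel>\<gamma>\<parallel>\<^sup>2) \<parallel>u - v\<parallel>\<^sup>2\<close>.  So solutions are unique.  Since \<open>hvi_sol\<close> is a
  definite description, their existence has to be proved as well.

  Existence.  \<open>\<Phi> v\<close> is convex and continuous, so Minty's form \<open>\<Phi> v u + F u \<le> F v\<close> of the problem
  is a system of closed convex conditions on \<open>u\<close>.  Strong monotonicity leaves room for an extra
  multiple of \<open>\<parallel>u - v\<parallel>\<^sup>2\<close>, which makes the conditions bounded.  Finitely many of them can be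
  satisfied up to any error: otherwise a theorem of the alternative for convex functions
  (\<open>finite_convex_alternative\<close>) yields weights for which the weighted barycentre contradicts
  monotonicity.  Weak compactness of bounded closed convex sets in a reflexive space
  (\<open>weakly_compact_fip\<close>) gives a common solution, and hemicontinuity turns it into a solution of
  the original problem (\<open>minty_imp_hvi_solution\<close>).

  Stability (\<open>hvi_solutions_weak_limit\<close>).  Let \<open>x n\<close> solve the problem for \<open>Fs n\<close>, let \<open>u\<close> solve it
  for \<open>F\<close>, and let \<open>w n \<longlonglongrightarrow> u\<close> be a recovery sequence.  Testing \<open>x n\<close> with \<open>w n\<close> bounds the \<open>x n\<close>, so
  along a subsequence \<open>x n\<close> converges weakly to some \<open>y\<close> and \<open>\<gamma> (x n)\<close> strongly to \<open>\<gamma> y\<close>.  Replacing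
  \<open>A (x n)\<close> by \<open>A (w n)\<close> at the price of \<open>c\<^sub>A \<parallel>x n - w n\<parallel>\<^sup>2\<close>, letting \<open>n\<close> tend to infinity by upper
  semicontinuity of \<open>J\<^sup>0\<close> and the Mosco conditions, and testing \<open>u\<close> with \<open>y\<close>, one gets
  \<open>limsup c\<^sub>A \<parallel>x n - w n\<parallel>\<^sup>2 \<le> c\<^sub>J \<parallel>\<gamma>\<parallel>\<^sup>2 \<parallel>u - y\<parallel>\<^sup>2\<close>.  The norm being weakly lower semicontinuous, the
  left-hand side is at least \<open>c\<^sub>A \<parallel>u - y\<parallel>\<^sup>2\<close>; hence \<open>y = u\<close>, and then the same estimate says that
  \<open>x n - w n\<close> tends to \<open>0\<close> in norm.
\<close>

section \<open>The Hahn-Banach theorem and separation\<close>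

definition sublinear :: "('a::real_vector \<Rightarrow> real) \<Rightarrow> bool" where
  "sublinear p \<longleftrightarrow> (\<forall>x y. p (x + y) \<le> p x + p y) \<and> (\<forall>x. \<forall>t>0. p (t *\<^sub>R x) = t * p x)"

lemma sublinearD:
  assumes "sublinear p"
  shows "p (x + y) \<le> p x + p y" and "t > 0 \<Longrightarrow> p (t *\<^sub>R x) = t * p x"
  using assms unfolding sublinear_def by auto

lemma sublinear_zero: "sublinear p \<Longrightarrow> p 0 = 0"
  using sublinearD(2)[of p 2 0] by simp

lemma sublinear_ge_minus: "sublinear p \<Longrightarrow> - p (- x) \<le> p x"
  using sublinearD(1)[of p x "- x"] sublinear_zero[of p] by simp

lemma sublinear_scale_nonneg: "sublinear p \<Longrightarrow> t \<ge> 0 \<Longrightarrow> p (t *\<^sub>R x) = t * p x"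
  using sublinearD(2)[of p t x] sublinear_zero[of p] by (cases "t = 0") auto

text \<open>Both the lower bound of a chain and the perturbations of a single functional used below are
  infima of this kind.\<close>

lemma sublinear_INF:
  fixes q :: "'i \<Rightarrow> 'a::real_vector \<Rightarrow> real"
  assumes ne: "I \<noteq> {}"
    and bdd: "\<And>x. bdd_below ((\<lambda>i. q i x) ` I)"
    and add: "\<And>i j x y. i \<in> I \<Longrightarrow> j \<in> I \<Longrightarrow> \<exists>k\<in>I. q k (x + y) \<le> q i x + q j y"
    and scale: "\<And>i x t. i \<in> I \<Longrightarrow> t > 0 \<Longrightarrow> \<exists>k\<in>I. q k (t *\<^sub>R x) \<le> t * q i x"
  shows "sublinear (\<lambda>x. INF i\<in>I. q i x)" (is "sublinear ?q")
proof -
  have le: "?q (t *\<^sub>R x) \<le> t * ?q x" if t: "t > 0" for t x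
  proof -
    have "?q (t *\<^sub>R x) / t \<le> ?q x"
    proof (rule cINF_greatest[OF ne])
      fix i assume "i \<in> I"
      then obtain k where "k \<in> I" "q k (t *\<^sub>R x) \<le> t * q i x"
        using scale t by blast
      with cINF_lower[OF bdd, of k "t *\<^sub>R x"] show "?q (t *\<^sub>R x) / t \<le> q i x"
        using t by (simp add: field_simps)
    qed
    then show ?thesis using t by (simp add: field_simps)
  qed
  have "?q (x + y) \<le> ?q x + ?q y" for x y
  proof -
    have "?q (x + y) - q j y \<le> ?q x" if j: "j \<in> I" for j
    proof (rule cINF_greatest[OF ne])
      fix i assume "i \<in> I"
      then obtain k where "k \<in> I" "q k (x + y) \<le> q i x + q j y"
        using add j by blast
      with cINF_lower[OF bdd, of k "x + y"] show "?q (x + y) - q j y \<le> q i x" by simp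
    qed
    then have "?q (x + y) - ?q x \<le> ?q y"
      by (intro cINF_greatest[OF ne]) (simp add: algebra_simps)
    then show ?thesis by simp
  qed
  moreover have "?q (t *\<^sub>R x) = t * ?q x" if t: "t > 0" for t x
  proof (rule antisym[OF le[OF t]])
    have "?q (inverse t *\<^sub>R (t *\<^sub>R x)) \<le> inverse t * ?q (t *\<^sub>R x)"
      using t by (intro le) auto
    then show "t * ?q x \<le> ?q (t *\<^sub>R x)"
      using t by (simp add: field_simps)
  qed
  ultimately show ?thesis unfolding sublinear_def by blast
qed

text \<open>Zorn's lemma applies to sublinear functionals below \<open>p\<close>: a chain is bounded below at each \<open>x\<close>,
  because \<open>q \<le> p\<close> forces \<open>- p (- x) \<le> q x\<close>, so its pointwise infimum is again sublinear.\<close>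

lemma minimal_sublinear_below:
  fixes p :: "'a::real_vector \<Rightarrow> real"
  assumes "sublinear p"
  obtains m where "sublinear m" "m \<le> p" "\<And>q. sublinear q \<Longrightarrow> q \<le> m \<Longrightarrow> q = m"
proof -
  define A where "A = {q. sublinear q \<and> q \<le> p}"
  have "\<exists>m\<in>A. \<forall>a\<in>A. a \<le> m \<longrightarrow> a = m"
  proof (rule predicate_Zorn[where P = "\<lambda>x y. y \<le> x"])
    show "partial_order_on A (relation_of (\<lambda>x y. y \<le> x) A)"
      by (rule partial_order_on_relation_ofI) auto
  next
    fix C assume C: "C \<in> Chains (relation_of (\<lambda>x y. y \<le> x) A)"
    then have sub: "C \<subseteq> A" unfolding Chains_def relation_of_def by auto
    have lin: "a \<le> b \<or> b \<le> a" if "a \<in> C" "b \<in> C" for a b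
      using C that unfolding Chains_def relation_of_def by auto
    show "\<exists>u\<in>A. \<forall>a\<in>C. u \<le> a"
    proof (cases "C = {}")
      case True
      then show ?thesis using assms unfolding A_def by auto
    next
      case False
      have CA: "sublinear q" "q \<le> p" if "q \<in> C" for q
        using sub that unfolding A_def by auto
      have bdd: "bdd_below ((\<lambda>q. q x) ` C)" for x
      proof (rule bdd_belowI2)
        fix q assume q: "q \<in> C"
        have "- p (- x) \<le> - q (- x)" using CA(2)[OF q] by (simp add: le_fun_def)
        also have "\<dots> \<le> q x" by (rule sublinear_ge_minus[OF CA(1)[OF q]])
        finally show "- p (- x) \<le> q x" .
      qed
      have "sublinear (\<lambda>x. INF q\<in>C. q x)"
      proof (rule sublinear_INF[OF False bdd])
        fix a b x y assume ab: "a \<in> C" "b \<in> C"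
        show "\<exists>k\<in>C. k (x + y) \<le> a x + b y"
        proof (cases "a \<le> b")
          case True
          then have "a (x + y) \<le> a x + b y"
            using sublinearD(1)[OF CA(1)[OF ab(1)], of x y]
            by (meson add_left_mono le_funD order_trans)
          then show ?thesis using ab by auto
        next
          case False
          then have "b \<le> a" using lin ab by blast
          then have "b (x + y) \<le> a x + b y"
            using sublinearD(1)[OF CA(1)[OF ab(2)], of x y]
            by (meson add_right_mono le_funD order_trans)
          then show ?thesis using ab by auto
        qed
      next
        fix q x and t :: real assume "q \<in> C" "t > 0"
        then show "\<exists>k\<in>C. k (t *\<^sub>R x) \<le> t * q x"
          using sublinearD(2)[OF CA(1), of q t x] by (intro bexI[of _ q]) auto
      qed
      moreover have low: "(\<lambda>x. INF q\<in>C. q x) \<le> q" if "q \<in> C" for q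
        using cINF_lower[OF bdd that] by (auto simp: le_fun_def)
      moreover have "(\<lambda>x. INF q\<in>C. q x) \<le> p"
        using False low CA(2) by (meson all_not_in_conv order_trans)
      ultimately show ?thesis unfolding A_def by blast
    qed
  qed
  then show thesis using that unfolding A_def
    by (metis (mono_tags, lifting) mem_Collect_eq order_trans)
qed

text \<open>A minimal sublinear functional is linear, so no extension from subspaces is involved.\<close>

lemma Hahn_Banach_sublinear:
  fixes p :: "'a::real_vector \<Rightarrow> real"
  assumes "sublinear p"
  obtains f where "linear f" "\<And>x. f x \<le> p x"
proof -
  obtain m where m: "sublinear m" "m \<le> p" and min: "\<And>q. sublinear q \<Longrightarrow> q \<le> m \<Longrightarrow> q = m"
    using minimal_sublinear_below[OF assms] by blast
  have super: "m x + m z \<le> m (x + z)" for x z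
  proof -
    \<comment> \<open>the infimum over \<open>t \<ge> 0\<close> is sublinear and below
      \<open>m\<close>, hence equal to \<open>m\<close>; the value at \<open>t = 1\<close> gives
      superadditivity\<close>
    define q where "q t x = m (x + t *\<^sub>R z) - t * m z" for t x
    have bdd: "bdd_below ((\<lambda>t. q t y) ` {0..})" for y
    proof (rule bdd_belowI2)
      fix t :: real assume t: "t \<in> {0..}"
      have "m (t *\<^sub>R z) \<le> m (y + t *\<^sub>R z) + m (- y)"
        using sublinearD(1)[OF m(1), of "y + t *\<^sub>R z" "- y"] by simp
      then show "- m (- y) \<le> q t y"
        using t sublinear_scale_nonneg[OF m(1), of t z] by (simp add: q_def)
    qed
    have "sublinear (\<lambda>x. INF t\<in>{0..}. q t x)"
    proof (rule sublinear_INF[OF _ bdd])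
      fix s t :: real and x y assume "s \<in> {0..}" "t \<in> {0..}"
      then show "\<exists>k\<in>{0..}. q k (x + y) \<le> q s x + q t y"
        using sublinearD(1)[OF m(1), of "x + s *\<^sub>R z" "y + t *\<^sub>R z"]
        by (intro bexI[of _ "s + t"]) (auto simp: q_def algebra_simps)
    next
      fix s t :: real and x assume "s \<in> {0..}" "t > 0"
      then show "\<exists>k\<in>{0..}. q k (t *\<^sub>R x) \<le> t * q s x"
        using sublinearD(2)[OF m(1), of t "x + s *\<^sub>R z"]
        by (intro bexI[of _ "t * s"]) (auto simp: q_def algebra_simps)
    qed auto
    moreover have "(\<lambda>x. INF t\<in>{0..}. q t x) \<le> m"
    proof (rule le_funI)
      fix y show "(INF t\<in>{0..}. q t y) \<le> m y"
        using cINF_lower[OF bdd, of 0 y] by (simp add: q_def)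
    qed
    ultimately have "(\<lambda>x. INF t\<in>{0..}. q t x) = m" by (rule min)
    then have "m x \<le> q 1 x"
      using cINF_lower[OF bdd, of 1 x] by (simp add: fun_eq_iff)
    then show ?thesis by (simp add: q_def)
  qed
  have add: "m (x + z) = m x + m z" for x z
    using super[of x z] sublinearD(1)[OF m(1), of x z] by simp
  have neg: "m (- x) = - m x" for x
    using add[of x "- x"] sublinear_zero[OF m(1)] by simp
  have "m (t *\<^sub>R x) = t * m x" for t x
  proof (cases "t \<ge> 0")
    case True
    then show ?thesis by (rule sublinear_scale_nonneg[OF m(1)])
  next
    case False
    then show ?thesis
      using sublinear_scale_nonneg[OF m(1), of "- t" x] neg[of "t *\<^sub>R x"] by simp
  qed
  then have "linear m" using add by (intro linearI) auto
  then show thesis using that m(2) by (simp add: le_fun_def)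
qed

text \<open>The quantity \<open>d\<close> is a lower bound for the distance of \<open>u\<close> to \<open>C\<close>, and \<open>d = 0\<close> is allowed.
  The case \<open>C = {0}\<close> yields norming functionals.\<close>

lemma separating_functional:
  fixes C :: "'a::real_normed_vector set"
  assumes conv: "convex C" and ne: "C \<noteq> {}" and dist: "\<And>c. c \<in> C \<Longrightarrow> d \<le> norm (c - u)"
  obtains f :: "'a \<Rightarrow>\<^sub>L real"
    where "\<And>x. blinfun_apply f x \<le> norm x" "\<And>c. c \<in> C \<Longrightarrow> blinfun_apply f c + d \<le> blinfun_apply f u"
proof -
  define I where "I = {0 :: real ..} \<times> C"
  \<comment> \<open>for \<open>t \<ge> 0\<close> and \<open>c \<in> C\<close> this is
    \<open>\<parallel>z - t (c - u)\<parallel> - t d\<close>: for \<open>t = 0\<close> it bounds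
    \<open>f z\<close> by \<open>\<parallel>z\<parallel>\<close>, for \<open>t = 1\<close> and
    \<open>z = c - u\<close> it bounds \<open>f (c - u)\<close> by \<open>- d\<close>\<close>
  define q where "q i z = norm (z - fst i *\<^sub>R (snd i - u)) - fst i * d" for i :: "real \<times> 'a" and z
  have bdd: "bdd_below ((\<lambda>i. q i z) ` I)" for z
  proof (rule bdd_belowI2)
    fix i assume i: "i \<in> I"
    have "fst i * d \<le> fst i * norm (snd i - u)"
      using i dist by (auto simp: I_def intro!: mult_left_mono)
    also have "\<dots> = norm (fst i *\<^sub>R (snd i - u))" using i by (auto simp: I_def)
    also have "\<dots> \<le> norm z + norm (z - fst i *\<^sub>R (snd i - u))"
      by (metis norm_minus_commute norm_triangle_sub)
    finally show "- norm z \<le> q i z" by (simp add: q_def)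
  qed
  have Ine: "I \<noteq> {}" using ne by (auto simp: I_def)
  have "sublinear (\<lambda>z. INF i\<in>I. q i z)"
  proof (rule sublinear_INF[OF Ine bdd])
    fix i j :: "real \<times> 'a" and x y assume ij: "i \<in> I" "j \<in> I"
    obtain s a t b where eq: "i = (s, a)" "j = (t, b)" by (cases i, cases j)
    have st: "s \<ge> 0" "t \<ge> 0" "a \<in> C" "b \<in> C" using ij eq by (auto simp: I_def)
    \<comment> \<open>the cone generated by \<open>C - u\<close> is convex\<close>
    have "\<exists>c\<in>C. (s + t) *\<^sub>R (c - u) = s *\<^sub>R (a - u) + t *\<^sub>R (b - u)"
    proof (cases "s + t = 0")
      case True
      then have "s = 0" "t = 0" using st by auto
      then show ?thesis using st by auto
    next
      case False
      define c where "c = (s / (s + t)) *\<^sub>R a + (t / (s + t)) *\<^sub>R b"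
      have "c \<in> C" unfolding c_def
        by (rule convexD[OF conv]) (use st False in \<open>auto simp: add_divide_distrib[symmetric]\<close>)
      moreover have "(s + t) *\<^sub>R c = s *\<^sub>R a + t *\<^sub>R b"
        using False by (simp add: c_def scaleR_add_right)
      then have "(s + t) *\<^sub>R (c - u) = s *\<^sub>R (a - u) + t *\<^sub>R (b - u)"
        by (simp add: algebra_simps)
      ultimately show ?thesis by blast
    qed
    then obtain c where c: "c \<in> C" "(s + t) *\<^sub>R (c - u) = s *\<^sub>R (a - u) + t *\<^sub>R (b - u)"
      by blast
    have "q (s + t, c) (x + y) \<le> q i x + q j y"
      using c(2) norm_triangle_ineq[of "x - s *\<^sub>R (a - u)" "y - t *\<^sub>R (b - u)"]
      unfolding q_def eq by (simp add: algebra_simps)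
    moreover have "(s + t, c) \<in> I" using c st by (simp add: I_def)
    ultimately show "\<exists>k\<in>I. q k (x + y) \<le> q i x + q j y" by blast
  next
    fix i :: "real \<times> 'a" and x and t :: real assume i: "i \<in> I" and t: "t > 0"
    have "q (t * fst i, snd i) (t *\<^sub>R x) = t * q i x"
    proof -
      have "norm (t *\<^sub>R x - (t * fst i) *\<^sub>R (snd i - u)) = norm (t *\<^sub>R (x - fst i *\<^sub>R (snd i - u)))"
        by (simp add: scaleR_diff_right)
      also have "\<dots> = t * norm (x - fst i *\<^sub>R (snd i - u))" using t by simp
      finally show ?thesis by (simp add: q_def right_diff_distrib)
    qed
    moreover have "(t * fst i, snd i) \<in> I" using i t by (auto simp: I_def)
    ultimately show "\<exists>k\<in>I. q k (t *\<^sub>R x) \<le> t * q i x" by (metis order_refl)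
  qed
  then obtain f where f: "linear f" "\<And>z. f z \<le> (INF i\<in>I. q i z)"
    using Hahn_Banach_sublinear by blast
  have fq: "f z \<le> q i z" if "i \<in> I" for i z
    using f(2)[of z] cINF_lower[OF bdd that, of z] by simp
  obtain c0 where c0: "c0 \<in> C" using ne by blast
  have fn: "f z \<le> norm z" for z
    using fq[of "(0, c0)" z] c0 by (simp add: I_def q_def)
  have "norm (f z) \<le> norm z * 1" for z
    using fn[of z] fn[of "- z"] linear_neg[OF f(1), of z] by simp
  then have "bounded_linear f"
    using f(1) by (intro bounded_linear_intro[of f 1])
      (auto simp: linear_add linear_scale)
  then have F: "blinfun_apply (Blinfun f) = f" by (rule bounded_linear_Blinfun_apply)
  have "f c + d \<le> f u" if "c \<in> C" for c
    using fq[of "(1, c)" "c - u"] that linear_diff[OF f(1), of c u] by (simp add: I_def q_def)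
  then show thesis using that[of "Blinfun f"] fn by (simp add: F)
qed

lemma norming_functional:
  fixes w :: "'v::real_normed_vector"
  obtains f :: "'v \<Rightarrow>\<^sub>L real" where "\<And>y. \<bar>blinfun_apply f y\<bar> \<le> norm y" "blinfun_apply f w = norm w"
proof -
  obtain f :: "'v \<Rightarrow>\<^sub>L real" where f: "\<And>y. blinfun_apply f y \<le> norm y"
    "\<And>c. c \<in> {0} \<Longrightarrow> blinfun_apply f c + norm w \<le> blinfun_apply f w"
    using separating_functional[of "{0}" "norm w" w] by auto
  have "\<bar>blinfun_apply f y\<bar> \<le> norm y" for y
    using f(1)[of y] f(1)[of "- y"] by (simp add: blinfun.minus_right abs_le_iff)
  moreover have "blinfun_apply f w = norm w"
    using f(1)[of w] f(2)[of 0] by (simp add: blinfun.zero_right)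
  ultimately show thesis using that by blast
qed

section \<open>Weak compactness in reflexive spaces\<close>

text \<open>Banach-Alaoglu and Mazur in one statement.  Points of \<open>B\<close> are embedded as evaluations into a
  product of compact intervals.  A common cluster point of the finite intersections is a bounded
  linear functional on the dual, hence by reflexivity the evaluation at some \<open>x\<close>; a set of the
  family missing \<open>x\<close> would be separated from it, contrary to the choice of the cluster point.\<close>

lemma weakly_compact_fip:
  fixes \<C> :: "'v::real_normed_vector set set"
  assumes refl: "reflexive_space TYPE('v)"
    and cc: "\<And>C. C \<in> \<C> \<Longrightarrow> convex C \<and> closed C"
    and B: "B \<in> \<C>" "bounded B"
    and fip: "\<And>\<D>. finite \<D> \<Longrightarrow> \<D> \<subseteq> \<C> \<Longrightarrow> \<Inter>\<D> \<noteq> {}"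
  obtains x where "\<And>C. C \<in> \<C> \<Longrightarrow> x \<in> C"
proof -
  obtain R where R: "\<And>x. x \<in> B \<Longrightarrow> norm x \<le> R" using B(2) unfolding bounded_iff by blast
  define ev :: "'v \<Rightarrow> ('v \<Rightarrow>\<^sub>L real) \<Rightarrow> real" where "ev x = (\<lambda>f. blinfun_apply f x)" for x
  define P where "P = PiE UNIV (\<lambda>f :: 'v \<Rightarrow>\<^sub>L real. {- (norm f * R) .. norm f * R})"
  have "compactin (product_topology (\<lambda>_. euclidean) UNIV) P"
    unfolding P_def compactin_PiE by simp
  then have cP: "compact P" by (simp add: euclidean_product_topology compactin_euclidean_iff)
  have coord: "continuous_on UNIV (\<lambda>\<psi> :: ('v \<Rightarrow>\<^sub>L real) \<Rightarrow> real. \<psi> f)" for f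
    by (rule continuous_on_product_coordinates)
  have evP: "ev x \<in> P" if "x \<in> B" for x
  proof -
    have "\<bar>blinfun_apply f x\<bar> \<le> norm f * R" for f :: "'v \<Rightarrow>\<^sub>L real"
      using norm_blinfun[of f x] mult_left_mono[OF R[OF that], of "norm f"] by simp
    then show ?thesis by (auto simp: P_def ev_def abs_le_iff minus_le_iff)
  qed
  have "P = {\<psi>. \<forall>f. - (norm f * R) \<le> \<psi> f \<and> \<psi> f \<le> norm f * R}"
    by (auto simp: P_def)
  also have "closed \<dots>"
    by (intro closed_Collect_all closed_Collect_conj closed_Collect_le coord continuous_intros)
  finally have clP: "closure (ev ` B) \<subseteq> P"
    using evP by (intro closure_minimal) auto
  have "closure (ev ` B) \<inter> \<Inter>((\<lambda>\<D>. closure (ev ` \<Inter>\<D>)) ` {\<D>. finite \<D> \<and> \<D> \<subseteq> \<C>}) \<noteq> {}"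
  proof (rule compact_imp_fip_image)
    show "compact (closure (ev ` B))"
      using clP cP closed_closure by (metis compact_Int_closed inf.absorb_iff2)
  next
    fix \<E> assume E: "finite \<E>" "\<E> \<subseteq> {\<D>. finite \<D> \<and> \<D> \<subseteq> \<C>}"
    then have "finite (insert B (\<Union>\<E>))" "insert B (\<Union>\<E>) \<subseteq> \<C>" using B by auto
    then obtain x where x: "x \<in> \<Inter>(insert B (\<Union>\<E>))" using fip by blast
    have "ev x \<in> closure (ev ` \<Inter>\<D>)" if "\<D> \<in> \<E>" for \<D>
      using x that closure_subset[of "ev ` \<Inter>\<D>"] by auto
    moreover have "ev x \<in> closure (ev ` B)"
      using x closure_subset[of "ev ` B"] by auto
    ultimately show "closure (ev ` B) \<inter> (\<Inter>\<D>\<in>\<E>. closure (ev ` \<Inter>\<D>)) \<noteq> {}" by blast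
  qed auto
  then obtain \<phi> where \<phi>B: "\<phi> \<in> closure (ev ` B)"
    and \<phi>: "\<And>\<D>. finite \<D> \<Longrightarrow> \<D> \<subseteq> \<C> \<Longrightarrow> \<phi> \<in> closure (ev ` \<Inter>\<D>)"
    by blast
  have closedB: "closure (ev ` B) \<subseteq> S" if "closed S" "\<And>x. ev x \<in> S" for S
    using that by (intro closure_minimal) auto
  \<comment> \<open>linearity is a closed condition on single coordinates, so it passes from
    evaluations to their limit\<close>
  have "\<phi> \<in> {\<psi>. \<psi> (f + g) = \<psi> f + \<psi> g}" for f g
    by (rule subsetD[OF closedB \<phi>B])
      (auto intro!: closed_Collect_eq continuous_intros coord simp: ev_def blinfun.add_left)
  then have add: "\<phi> (f + g) = \<phi> f + \<phi> g" for f g by simp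
  have "\<phi> \<in> {\<psi>. \<psi> (t *\<^sub>R f) = t * \<psi> f}" for f t
    by (rule subsetD[OF closedB \<phi>B])
      (auto intro!: closed_Collect_eq continuous_intros coord simp: ev_def blinfun.scaleR_left)
  then have scale: "\<phi> (t *\<^sub>R f) = t * \<phi> f" for f t by simp
  have "\<phi> \<in> P" using \<phi>B clP by blast
  then have "- (norm f * R) \<le> \<phi> f \<and> \<phi> f \<le> norm f * R" for f
    unfolding P_def PiE_def by (auto simp: PiE_iff)
  then have "norm (\<phi> f) \<le> norm f * R" for f by (simp add: abs_le_iff minus_le_iff)
  then have bl: "bounded_linear \<phi>"
    by (intro bounded_linear_intro[of \<phi> R]) (auto simp: add scale)
  obtain x where x: "\<And>f. blinfun_apply (Blinfun \<phi>) f = blinfun_apply f x"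
    using refl unfolding reflexive_space_def by blast
  then have \<phi>x: "\<phi> f = blinfun_apply f x" for f
    by (simp add: bounded_linear_Blinfun_apply[OF bl])
  have "x \<in> C" if C: "C \<in> \<C>" for C
  proof (rule ccontr)
    assume "x \<notin> C"
    then obtain d where d: "d > 0" "ball x d \<inter> C = {}"
      using cc[OF C] by (meson Compl_iff disjoint_iff open_Compl open_contains_ball subsetD)
    have dist: "d \<le> norm (c - x)" if "c \<in> C" for c
      using d that by (force simp: dist_norm norm_minus_commute)
    have ne: "C \<noteq> {}" using fip[of "{C}"] C by simp
    have "convex C" using cc[OF C] by simp
    then obtain f where f: "\<And>c. c \<in> C \<Longrightarrow> blinfun_apply f c + d \<le> blinfun_apply f x"
      using separating_functional[OF _ ne dist] by metis
    have "\<phi> \<in> closure (ev ` C)" using \<phi>[of "{C}"] C by simp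
    also have "\<dots> \<subseteq> {\<psi>. \<psi> f \<le> blinfun_apply f x - d}"
    proof (rule closure_minimal)
      show "ev ` C \<subseteq> {\<psi>. \<psi> f \<le> blinfun_apply f x - d}"
        using f by (force simp: ev_def)
      show "closed {\<psi>. \<psi> f \<le> blinfun_apply f x - d}"
        by (intro closed_Collect_le coord continuous_intros)
    qed
    finally show False using d \<phi>x by simp
  qed
  then show thesis by (rule that)
qed

text \<open>The witness consists of the rational combinations of the \<open>x n\<close>, built up one vector at a
  time.\<close>

lemma countable_dense_in_span_range:
  fixes x :: "nat \<Rightarrow> 'v::real_normed_vector"
  obtains D where "countable D" "span (range x) \<subseteq> closure D"
proof -
  define E :: "nat \<Rightarrow> 'v set"
    where "E = rec_nat {0} (\<lambda>n S. (\<lambda>(d, q). d + q *\<^sub>R x n) ` (S \<times> \<rat>))"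
  have E0: "E 0 = {0}" and ES: "E (Suc n) = (\<lambda>(d, q). d + q *\<^sub>R x n) ` (E n \<times> \<rat>)" for n
    by (simp_all add: E_def)
  have "countable (E n)" for n
    by (induction n) (auto simp: E0 ES countable_rat)
  then have cD: "countable (\<Union>n. E n)" by simp
  have dense: "span (x ` {..<n}) \<subseteq> closure (E n)" for n
  proof (induction n)
    case 0
    then show ?case by (simp add: E0)
  next
    case (Suc n)
    show ?case
    proof
      fix w assume "w \<in> span (x ` {..<Suc n})"
      then have "w \<in> span (insert (x n) (x ` {..<n}))" by (simp add: lessThan_Suc)
      then obtain a where a: "w - a *\<^sub>R x n \<in> span (x ` {..<n})"
        unfolding span_insert by blast
      show "w \<in> closure (E (Suc n))"
      proof (unfold closure_approachable, intro allI impI)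
        fix e :: real assume e: "e > 0"
        obtain d where d: "d \<in> E n" "dist d (w - a *\<^sub>R x n) < e / 2"
          using a Suc e unfolding closure_approachable by (meson half_gt_zero subsetD closure_approachable)
        obtain q where q: "q \<in> \<rat>" "a < q" "q < a + e / 2 / (norm (x n) + 1)"
          using Rats_dense_in_real[of a "a + e / 2 / (norm (x n) + 1)"] e
          by (auto simp: add_nonneg_pos)
        have "\<bar>q - a\<bar> * norm (x n) \<le> (e / 2 / (norm (x n) + 1)) * (norm (x n) + 1)"
          using q by (intro mult_mono) auto
        also have "\<dots> = e / 2"
          using add_nonneg_pos[OF norm_ge_zero zero_less_one, of "x n"]
          by (metis less_irrefl nonzero_eq_divide_eq)
        finally have "norm ((q - a) *\<^sub>R x n) \<le> e / 2" by simp
        moreover have eq: "(d + q *\<^sub>R x n) - w = (d - (w - a *\<^sub>R x n)) + (q - a) *\<^sub>R x n"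
          by (simp add: algebra_simps)
        ultimately have "dist (d + q *\<^sub>R x n) w < e"
          using d(2) norm_triangle_ineq[of "d - (w - a *\<^sub>R x n)" "(q - a) *\<^sub>R x n"]
          unfolding dist_norm eq by linarith
        moreover have "d + q *\<^sub>R x n \<in> E (Suc n)" using d q by (auto simp: ES)
        ultimately show "\<exists>y\<in>E (Suc n). dist y w < e" by blast
      qed
    qed
  qed
  have sp: "span (range x) \<subseteq> closure (\<Union>n. E n)"
  proof
    fix w assume "w \<in> span (range x)"
    then obtain T a where "finite T" "T \<subseteq> range x" "w = (\<Sum>v\<in>T. a v *\<^sub>R v)"
      unfolding span_explicit by blast
    then have T: "finite T" "T \<subseteq> range x" "w \<in> span T"
      by (auto intro!: span_sum intro: span_scale span_base)
    then obtain J where J: "finite J" "T = x ` J" by (meson finite_subset_image subset_UNIV)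
    obtain n where n: "J \<subseteq> {..<n}"
      using J(1) finite_nat_iff_bounded by blast
    have "w \<in> span (x ` {..<n})"
      using T(3) J(2) span_mono[OF image_mono[OF n, of x]] by auto
    then have "w \<in> closure (E n)" using dense[of n] by auto
    then show "w \<in> closure (\<Union>n. E n)" using closure_mono[of "E n" "\<Union>n. E n"] by blast
  qed
  then show thesis using that cD by blast
qed

text \<open>Norming functionals of a dense sequence already separate points: a functional
  norming \<open>d\<close> cannot vanish at a point \<open>w\<close> whose distance to \<open>d\<close> is less than \<open>norm w / 2\<close>.\<close>

lemma countable_separating_functionals:
  fixes x :: "nat \<Rightarrow> 'v::real_normed_vector"
  obtains g :: "nat \<Rightarrow> 'v \<Rightarrow>\<^sub>L real"
    where "\<And>w. w \<in> closure (span (range x)) \<Longrightarrow> (\<And>n. blinfun_apply (g n) w = 0) \<Longrightarrow> w = 0"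
proof -
  obtain D where D: "countable D" "span (range x) \<subseteq> closure D"
    using countable_dense_in_span_range by metis
  have clD: "closure (span (range x)) \<subseteq> closure D"
    using D(2) by (simp add: closure_minimal)
  have "D \<noteq> {}" using D(2) span_zero by fastforce
  then have d: "D = range (from_nat_into D)" using D(1) by (simp add: range_from_nat_into)
  define d where "d = from_nat_into D"
  note d = d[folded d_def]
  have "\<exists>f :: 'v \<Rightarrow>\<^sub>L real. (\<forall>y. \<bar>blinfun_apply f y\<bar> \<le> norm y) \<and> blinfun_apply f (d n) = norm (d n)" for n
    by (rule norming_functional[of "d n"]) blast
  then obtain g :: "nat \<Rightarrow> 'v \<Rightarrow>\<^sub>L real" where g: "\<And>n y. \<bar>blinfun_apply (g n) y\<bar> \<le> norm y"
    "\<And>n. blinfun_apply (g n) (d n) = norm (d n)"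
    by metis
  show thesis
  proof (rule that[of g])
    fix w assume w: "w \<in> closure (span (range x))" "\<And>n. blinfun_apply (g n) w = 0"
    show "w = 0"
    proof (rule ccontr)
      assume "w \<noteq> 0"
      then have "norm w / 2 > 0" by simp
      then obtain n where n: "dist (d n) w < norm w / 2"
        using w(1) clD d unfolding closure_approachable by (metis closure_approachable rangeE subsetD)
      have "norm (d n) \<le> blinfun_apply (g n) (d n - w)"
        using g(2)[of n] w(2)[of n] by (simp add: blinfun.diff_right)
      also have "\<dots> \<le> norm (d n - w)" using g(1)[of n "d n - w"] by simp
      finally show False
        using n norm_triangle_ineq2[of w "d n"] by (simp add: dist_norm norm_minus_commute)
    qed
  qed
qed

text \<open>A countable product of compact intervals is metrizable, hence sequentially compact; this
  replaces a diagonal argument.\<close>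

lemma bounded_sequence_coordinatewise_convergent:
  fixes x :: "nat \<Rightarrow> 'v::real_normed_vector" and g :: "nat \<Rightarrow> 'v \<Rightarrow>\<^sub>L real"
  assumes "bounded (range x)"
  obtains r where "strict_mono r" "\<And>n. convergent (\<lambda>k. blinfun_apply (g n) (x (r k)))"
proof -
  obtain R where R: "\<And>k. norm (x k) \<le> R" using assms unfolding bounded_iff by blast
  define y where "y k n = blinfun_apply (g n) (x k)" for k n
  define P where "P = PiE UNIV (\<lambda>n. {- (norm (g n) * R) .. norm (g n) * R})"
  have "compactin (product_topology (\<lambda>_. euclidean) UNIV) P"
    unfolding P_def compactin_PiE by simp
  then have "compact P" by (simp add: euclidean_product_topology compactin_euclidean_iff)
  then have "seq_compact P" by (simp add: compact_eq_seq_compact_metric)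
  moreover have "y k \<in> P" for k
  proof -
    have "\<bar>y k n\<bar> \<le> norm (g n) * R" for n
      using norm_blinfun[of "g n" "x k"] mult_left_mono[OF R[of k], of "norm (g n)"] by (simp add: y_def)
    then show ?thesis by (auto simp: P_def abs_le_iff minus_le_iff)
  qed
  ultimately obtain l r where r: "strict_mono r" "(y \<circ> r) \<longlonglongrightarrow> l"
    using seq_compactE by metis
  have "(\<lambda>k. (y \<circ> r) k n) \<longlonglongrightarrow> l n" for n
    using continuous_on_product_coordinates r(2)
    by (rule continuous_on_tendsto_compose) auto
  then show thesis using that r(1) by (auto simp: convergent_def y_def)
qed

text \<open>Every weak limit point of \<open>x\<close> lies in all the closed convex hulls of its tails.  Their
  intersection serves as a substitute for the set of weak limit points.\<close>

definition tail_hull :: "(nat \<Rightarrow> 'v::real_normed_vector) \<Rightarrow> nat \<Rightarrow> 'v set" where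
  "tail_hull x m = closure (convex hull (x ` {m..}))"

lemma tail_hulls_meet:
  fixes x :: "nat \<Rightarrow> 'v::real_normed_vector"
  assumes "reflexive_space TYPE('v)" "bounded (range x)"
  obtains y where "\<And>m. y \<in> tail_hull x m"
proof -
  have "bounded (tail_hull x 0)"
    using assms(2) by (simp add: tail_hull_def bounded_closure bounded_convex_hull atLeast_0)
  moreover have "convex C \<and> closed C" if "C \<in> range (tail_hull x)" for C
    using that by (auto simp: tail_hull_def convex_closure)
  moreover have "\<Inter>\<D> \<noteq> {}" if D: "finite \<D>" "\<D> \<subseteq> range (tail_hull x)" for \<D>
  proof -
    obtain M where M: "finite M" "\<D> = tail_hull x ` M"
      using D by (meson finite_subset_image)
    obtain n where "M \<subseteq> {..n}" using M(1) by (auto simp: finite_nat_iff_bounded_le)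
    then have "x n \<in> tail_hull x m" if "m \<in> M" for m
      unfolding tail_hull_def using that closure_subset hull_subset
      by (metis atLeast_iff atMost_iff image_eqI subsetD)
    then show ?thesis using M by auto
  qed
  ultimately obtain y where "\<And>C. C \<in> range (tail_hull x) \<Longrightarrow> y \<in> C"
    using weakly_compact_fip[OF assms(1), of "range (tail_hull x)" "tail_hull x 0"]
    by (metis rangeI)
  then show thesis by (intro that) blast
qed

lemma tail_hull_le:
  fixes f :: "'v::real_normed_vector \<Rightarrow>\<^sub>L real"
  assumes "y \<in> tail_hull x m" "\<And>k. k \<ge> m \<Longrightarrow> blinfun_apply f (x k) \<le> a"
  shows "blinfun_apply f y \<le> a"
proof -
  have "convex {z. blinfun_apply f z \<le> a}"
    by (auto simp: convex_def blinfun.add_right blinfun.scaleR_right intro!: convex_bound_le)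
  moreover have "closed {z. blinfun_apply f z \<le> a}"
    by (intro closed_Collect_le continuous_intros)
  ultimately have "tail_hull x m \<subseteq> {z. blinfun_apply f z \<le> a}"
    unfolding tail_hull_def using assms(2) by (intro closure_minimal hull_minimal) auto
  then show ?thesis using assms(1) by blast
qed

lemma tail_hull_ge:
  fixes f :: "'v::real_normed_vector \<Rightarrow>\<^sub>L real"
  assumes "y \<in> tail_hull x m" "\<And>k. k \<ge> m \<Longrightarrow> a \<le> blinfun_apply f (x k)"
  shows "a \<le> blinfun_apply f y"
  using tail_hull_le[of y x m "- f" "- a"] assms by (simp add: blinfun.minus_left)

lemma tail_hull_lim:
  fixes f :: "'v::real_normed_vector \<Rightarrow>\<^sub>L real"
  assumes y: "\<And>m. y \<in> tail_hull x m" and l: "(\<lambda>k. blinfun_apply f (x k)) \<longlonglongrightarrow> l"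
  shows "blinfun_apply f y = l"
proof (rule antisym)
  show "blinfun_apply f y \<le> l"
  proof (rule field_le_epsilon)
    fix e :: real assume "e > 0"
    then have "\<forall>\<^sub>F k in sequentially. blinfun_apply f (x k) < l + e"
      using order_tendstoD(2)[OF l, of "l + e"] by simp
    then obtain m where "\<forall>k\<ge>m. blinfun_apply f (x k) < l + e"
      unfolding eventually_sequentially by blast
    then show "blinfun_apply f y \<le> l + e"
      by (intro tail_hull_le[OF y[of m]]) (auto intro: less_imp_le)
  qed
  show "l \<le> blinfun_apply f y"
  proof (rule field_le_epsilon)
    fix e :: real assume "e > 0"
    then have "\<forall>\<^sub>F k in sequentially. l - e < blinfun_apply f (x k)"
      using order_tendstoD(1)[OF l, of "l - e"] by simp
    then obtain m where "\<forall>k\<ge>m. l - e < blinfun_apply f (x k)"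
      unfolding eventually_sequentially by blast
    then have "l - e \<le> blinfun_apply f y"
      by (intro tail_hull_ge[OF y[of m]]) (auto intro: less_imp_le)
    then show "l \<le> blinfun_apply f y + e" by simp
  qed
qed

lemma tail_hull_subsequence:
  assumes "strict_mono r"
  shows "tail_hull (x \<circ> r) m \<subseteq> tail_hull x m"
  unfolding tail_hull_def
  by (intro closure_mono hull_mono) (use seq_suble[OF assms] order_trans in \<open>fastforce\<close>)

lemma tail_hull_subset_closed_span: "tail_hull x m \<subseteq> closure (span (range x))"
  unfolding tail_hull_def
  by (intro closure_mono hull_minimal) (auto intro: span_base subspace_imp_convex)

lemma closure_span_diff:
  fixes u w :: "'v::real_normed_vector"
  assumes "u \<in> closure (span S)" "w \<in> closure (span S)"
  shows "u - w \<in> closure (span S)"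
proof -
  obtain a where a: "\<And>n::nat. a n \<in> span S" "a \<longlonglongrightarrow> u"
    using assms(1) unfolding closure_sequential by blast
  obtain b where b: "\<And>n::nat. b n \<in> span S" "b \<longlonglongrightarrow> w"
    using assms(2) unfolding closure_sequential by blast
  show ?thesis unfolding closure_sequential
    using a b by (intro exI[of _ "\<lambda>n. a n - b n"]) (auto intro: span_diff tendsto_diff)
qed

text \<open>Choose a subsequence \<open>z\<close> along which countably many functionals converge that separate the
  points of the closed span.  These functionals are constant on the intersection of the tail
  hulls of \<open>z\<close>, which therefore is a single point \<open>y\<close>.  A further functional failing to
  converge to its value at \<open>y\<close> would single out a subsequence of \<open>z\<close> whose tail hulls meet in a
  point different from \<open>y\<close>.\<close>

theorem bounded_imp_weakly_convergent_subsequence: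
  fixes x :: "nat \<Rightarrow> 'v::real_normed_vector"
  assumes refl: "reflexive_space TYPE('v)" and bdd: "bounded (range x)"
  obtains r y where "strict_mono r" "weakly_converges (x \<circ> r) y"
proof -
  obtain g :: "nat \<Rightarrow> 'v \<Rightarrow>\<^sub>L real"
    where sep: "\<And>w. w \<in> closure (span (range x)) \<Longrightarrow> (\<And>n. blinfun_apply (g n) w = 0) \<Longrightarrow> w = 0"
    by (rule countable_separating_functionals[of x]) blast
  obtain r where r: "strict_mono r" and conv: "\<And>n. convergent (\<lambda>k. blinfun_apply (g n) (x (r k)))"
    by (rule bounded_sequence_coordinatewise_convergent[OF bdd, where g = g]) blast
  define z where "z = x \<circ> r"
  have bz: "bounded (range (z \<circ> s))" for s
    by (rule bounded_subset[OF bdd]) (auto simp: z_def)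
  obtain y where y: "\<And>m. y \<in> tail_hull z m"
    using tail_hulls_meet[OF refl bz[of id]] by auto
  have inW: "tail_hull z m \<subseteq> closure (span (range x))" for m
    using tail_hull_subset_closed_span[of x m] tail_hull_subsequence[OF r, of x m] by (auto simp: z_def)
  have uniq: "y' = y" if y': "\<And>m. y' \<in> tail_hull z m" for y'
  proof -
    have "y' - y \<in> closure (span (range x))"
      by (rule closure_span_diff) (use y y' inW in blast)+
    moreover have "blinfun_apply (g n) (y' - y) = 0" for n
    proof -
      obtain l where "(\<lambda>k. blinfun_apply (g n) (z k)) \<longlonglongrightarrow> l"
        using conv[of n] by (auto simp: convergent_def z_def)
      then show ?thesis
        using tail_hull_lim[OF y, of "g n" l] tail_hull_lim[OF y', of "g n" l]
        by (simp add: blinfun.diff_right)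
    qed
    ultimately show ?thesis using sep by force
  qed
  have upper: "\<forall>\<^sub>F k in sequentially. blinfun_apply f (z k) < a" if a: "blinfun_apply f y < a"
    for f :: "'v \<Rightarrow>\<^sub>L real" and a
  proof (rule ccontr)
    assume "\<not> ?thesis"
    then have "\<exists>\<^sub>F k in sequentially. a \<le> blinfun_apply f (z k)"
      by (simp add: not_eventually not_less)
    then have "infinite {k. a \<le> blinfun_apply f (z k)}"
      by (simp add: frequently_cofinite[symmetric] cofinite_eq_sequentially)
    from infinite_enumerate[OF this] obtain s :: "nat \<Rightarrow> nat"
      where s: "strict_mono s" "\<forall>k. s k \<in> {k. a \<le> blinfun_apply f (z k)}" by blast
    obtain y' where y': "\<And>m. y' \<in> tail_hull (z \<circ> s) m"
      using tail_hulls_meet[OF refl bz[of s]] by metis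
    have "y' = y"
    proof (rule uniq)
      show "y' \<in> tail_hull z m" for m using y'[of m] tail_hull_subsequence[OF s(1), of z m] by auto
    qed
    moreover have "a \<le> blinfun_apply f y'"
      using tail_hull_ge[OF y'[of 0]] s(2) by simp
    ultimately show False using a by simp
  qed
  have "(\<lambda>k. blinfun_apply f (z k)) \<longlonglongrightarrow> blinfun_apply f y" for f :: "'v \<Rightarrow>\<^sub>L real"
  proof (rule order_tendstoI)
    fix a assume "a < blinfun_apply f y"
    then have "\<forall>\<^sub>F k in sequentially. blinfun_apply (- f) (z k) < - a"
      by (intro upper) (simp add: blinfun.minus_left)
    then show "\<forall>\<^sub>F k in sequentially. a < blinfun_apply f (z k)"
      by (simp add: blinfun.minus_left)
  qed (rule upper)
  then show thesis using that[OF r, of y] unfolding weakly_converges_def z_def by blast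
qed

section \<open>A theorem of the alternative for convex functions\<close>

text \<open>If neither function is nonnegative, the weight ratio must lie between all the quotients
  \<open>- h y / g y\<close> with \<open>h y < 0\<close> and all the quotients \<open>h x / (- g x)\<close> with \<open>g x < 0\<close>.  These two sets of quotients
  are in the right order, since otherwise both functions would be negative at some point
  between \<open>x\<close> and \<open>y\<close>.\<close>

lemma two_convex_alternative:
  fixes g h :: "'a::real_vector \<Rightarrow> real"
  assumes S: "convex S" and g: "convex_on S g" and h: "convex_on S h"
    and none: "\<And>x. x \<in> S \<Longrightarrow> g x \<ge> 0 \<or> h x \<ge> 0"
  obtains l where "0 \<le> l" "l \<le> 1" "\<And>x. x \<in> S \<Longrightarrow> l * g x + (1 - l) * h x \<ge> 0"
proof (cases "(\<forall>x\<in>S. g x \<ge> 0) \<or> (\<forall>x\<in>S. h x \<ge> 0)")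
  case True
  then show thesis using that[of 0] that[of 1] by auto
next
  case False
  then obtain x0 y0 where x0: "x0 \<in> S" "g x0 < 0" and y0: "y0 \<in> S" "h y0 < 0" by force
  define r where "r x = h x / (- g x)" for x
  have cross: "h y * g x \<le> g y * h x" if x: "x \<in> S" "g x < 0" and y: "y \<in> S" "h y < 0" for x y
  proof (rule ccontr)
    assume "\<not> h y * g x \<le> g y * h x"
    then have lt: "g y * h x < h y * g x" by simp
    have nn: "h x \<ge> 0" "g y \<ge> 0" using none[of x] none[of y] x y by auto
    define s where "s t = (1 - t) *\<^sub>R x + t *\<^sub>R y" for t :: real
    have sg: "g (s t) \<le> (1 - t) * g x + t * g y" and sh: "h (s t) \<le> (1 - t) * h x + t * h y"
      and sS: "s t \<in> S"
      if "0 \<le> t" "t \<le> 1" for t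
      using convex_onD[OF g, of t x y] convex_onD[OF h, of t x y] S that x y
      by (auto simp: s_def convex_def)
    define a where "a = - g x" define b where "b = g y"
    define c where "c = h x" define e where "e = - h y"
    have pos: "a > 0" "b \<ge> 0" "c \<ge> 0" "e > 0" "b * c < a * e"
      using x y nn lt by (auto simp: a_def b_def c_def e_def mult.commute)
    \<comment> \<open>for this \<open>t\<close> the two convexity bounds coincide; their common
      value is \<open>(b c - a e) / N\<close>\<close>
    define N where "N = a + b + c + e"
    have N: "N > 0" using pos by (simp add: N_def)
    define t where "t = (a + c) / N"
    have t: "0 \<le> t" "t \<le> 1" using pos N by (auto simp: t_def N_def)
    have 1: "1 - t = (b + e) / N" using N by (simp add: t_def N_def field_simps)
    have neg: "(b * c - a * e) / N < 0" using pos N by (simp add: divide_neg_pos)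
    have "(1 - t) * (- a) + t * b = (b * c - a * e) / N"
      unfolding 1 unfolding t_def by (simp add: add_divide_distrib diff_divide_distrib algebra_simps)
    then have n1: "(1 - t) * g x + t * g y < 0" using neg by (simp add: a_def b_def)
    have "(1 - t) * c + t * (- e) = (b * c - a * e) / N"
      unfolding 1 unfolding t_def by (simp add: add_divide_distrib diff_divide_distrib algebra_simps)
    then have n2: "(1 - t) * h x + t * h y < 0" using neg by (simp add: c_def e_def)
    show False using none[OF sS[OF t]] sg[OF t] sh[OF t] n1 n2 by linarith
  qed
  define S' where "S' = {x\<in>S. g x < 0}"
  have S'ne: "S' \<noteq> {}" using x0 by (auto simp: S'_def)
  have bdd: "bdd_below (r ` S')"
    by (rule bdd_belowI2[of _ 0])
      (use none in \<open>force simp: S'_def r_def divide_nonneg_neg\<close>)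
  define m where "m = (INF x\<in>S'. r x)"
  have m0: "m \<ge> 0" unfolding m_def
    by (rule cINF_greatest[OF S'ne]) (use none in \<open>force simp: S'_def r_def divide_nonneg_neg\<close>)
  have all: "m * g z + h z \<ge> 0" if z: "z \<in> S" for z
  proof -
    consider "g z < 0" | "h z < 0" "g z \<ge> 0" | "g z \<ge> 0" "h z \<ge> 0" by linarith
    then show ?thesis
    proof cases
      case 1
      then have "m \<le> r z" unfolding m_def using z by (intro cINF_lower[OF bdd]) (auto simp: S'_def)
      then show ?thesis using 1 by (simp add: r_def field_simps)
    next
      case 2
      have gz: "g z > 0"
        using cross[OF x0 z 2(1)] 2 x0 by (metis leD mult_neg_neg mult_zero_left order_le_less)
      have "- h z / g z \<le> m" unfolding m_def
      proof (rule cINF_greatest[OF S'ne])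
        fix x assume "x \<in> S'"
        then have x: "x \<in> S" "g x < 0" by (auto simp: S'_def)
        show "- h z / g z \<le> r x"
          using cross[OF x z 2(1)] x gz by (simp add: r_def field_simps)
      qed
      then show ?thesis using gz by (simp add: field_simps)
    next
      case 3
      then show ?thesis using m0 by simp
    qed
  qed
  have "m / (m + 1) * g x + (1 - m / (m + 1)) * h x \<ge> 0" if "x \<in> S" for x
  proof -
    have "1 - m / (m + 1) = 1 / (m + 1)" using m0 by (simp add: field_simps)
    then have "m / (m + 1) * g x + (1 - m / (m + 1)) * h x = (m * g x + h x) / (m + 1)"
      by (simp add: add_divide_distrib)
    then show ?thesis using all[OF that] m0 by simp
  qed
  then show thesis using that[of "m / (m + 1)"] m0 by simp
qed

lemma convex_on_weighted_sum:
  assumes "finite I" "convex S" "\<And>i. i \<in> I \<Longrightarrow> convex_on S (g i)" "\<And>i. i \<in> I \<Longrightarrow> (0::real) \<le> l i"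
  shows "convex_on S (\<lambda>x. \<Sum>i\<in>I. l i * g i x)"
  using assms by (induction I rule: finite_induct) (auto intro!: convex_on_add convex_on_cmul simp: convex_on_const)

text \<open>Induction on the number of functions: the induction hypothesis is applied on the convex set
  where the new function is negative, and the resulting combination is then paired with the new
  function on all of \<open>S\<close>.\<close>

lemma finite_convex_alternative:
  fixes g :: "'i \<Rightarrow> 'a::real_vector \<Rightarrow> real"
  assumes "finite I" "I \<noteq> {}" "convex S" "\<And>i. i \<in> I \<Longrightarrow> convex_on S (g i)"
    and "\<And>x. x \<in> S \<Longrightarrow> \<exists>i\<in>I. g i x \<ge> 0"
  obtains l where "\<And>i. i \<in> I \<Longrightarrow> l i \<ge> 0" "(\<Sum>i\<in>I. l i) = 1"
    "\<And>x. x \<in> S \<Longrightarrow> (\<Sum>i\<in>I. l i * g i x) \<ge> 0"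
proof -
  have "\<exists>l. (\<forall>i\<in>I. l i \<ge> 0) \<and> (\<Sum>i\<in>I. l i) = 1 \<and> (\<forall>x\<in>S. (\<Sum>i\<in>I. l i * g i x) \<ge> 0)"
    using assms
  proof (induction I arbitrary: S rule: finite_ne_induct)
    case (singleton i)
    then show ?case by (intro exI[of _ "\<lambda>_. 1"]) auto
  next
    case (insert i I)
    define T where "T = {x\<in>S. g i x < 0}"
    have cT: "convex T"
    proof (rule convexI)
      fix x y and u v :: real assume x: "x \<in> T" and y: "y \<in> T" and uv: "0 \<le> u" "0 \<le> v" "u + v = 1"
      have "g i (u *\<^sub>R x + v *\<^sub>R y) \<le> u * g i x + v * g i y"
        using insert.prems(2)[of i] x y uv by (simp add: convex_on_def T_def)
      also have "\<dots> < 0" using x y uv by (intro convex_bound_lt) (auto simp: T_def)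
      finally show "u *\<^sub>R x + v *\<^sub>R y \<in> T"
        using insert.prems(1) x y uv by (auto simp: T_def convex_def)
    qed
    have cg: "convex_on T (g j)" if "j \<in> I" for j
      by (rule convex_on_subset[OF insert.prems(2)]) (use that cT in \<open>auto simp: T_def\<close>)
    have "\<exists>j\<in>I. g j x \<ge> 0" if "x \<in> T" for x
      using insert.prems(3)[of x] that by (force simp: T_def)
    with insert.IH[OF cT cg] obtain l where
      l: "\<And>j. j \<in> I \<Longrightarrow> l j \<ge> 0" "(\<Sum>j\<in>I. l j) = 1"
      "\<And>x. x \<in> T \<Longrightarrow> (\<Sum>j\<in>I. l j * g j x) \<ge> 0" by blast
    define h where "h x = (\<Sum>j\<in>I. l j * g j x)" for x
    have ch: "convex_on S h" unfolding h_def
      using insert.hyps(1) insert.prems l by (intro convex_on_weighted_sum) auto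
    have "g i x \<ge> 0 \<or> h x \<ge> 0" if "x \<in> S" for x
      using l(3)[of x] that by (force simp: h_def T_def)
    then obtain s where s: "0 \<le> s" "s \<le> 1" "\<And>x. x \<in> S \<Longrightarrow> s * g i x + (1 - s) * h x \<ge> 0"
      using two_convex_alternative[OF insert.prems(1) _ ch, of "g i"] insert.prems(2) by blast
    define k where "k = (\<lambda>j. if j = i then s else (1 - s) * l j)"
    have ki: "k i = s" by (simp add: k_def)
    have kj: "(\<Sum>j\<in>I. k j * f j) = (1 - s) * (\<Sum>j\<in>I. l j * f j)" for f
      unfolding sum_distrib_left by (rule sum.cong) (use insert.hyps in \<open>auto simp: k_def\<close>)
    have "\<forall>j\<in>insert i I. k j \<ge> 0" using s l by (auto simp: k_def)
    moreover have "(\<Sum>j\<in>insert i I. k j) = 1"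
      using kj[of "\<lambda>_. 1"] l(2) insert.hyps by (simp add: ki)
    moreover have "\<forall>x\<in>S. (\<Sum>j\<in>insert i I. k j * g j x) \<ge> 0"
      using kj[of "\<lambda>j. g j _"] s(3) insert.hyps by (simp add: ki h_def)
    ultimately show ?case by blast
  qed
  then show thesis using that by blast
qed

section \<open>Minty equilibria of strongly monotone bifunctions\<close>

text \<open>Meaningful on \<open>domF F\<close> for proper \<open>F\<close>; where \<open>F\<close> is infinite the conversion yields the
  default value \<open>0\<close>.\<close>

definition fin_val :: "('v \<Rightarrow> ereal) \<Rightarrow> 'v \<Rightarrow> real" where
  "fin_val F v = real_of_ereal (F v)"

lemma fin_val: "proper_fun F \<Longrightarrow> v \<in> domF F \<Longrightarrow> F v = ereal (fin_val F v)"
  unfolding proper_fun_def domF_def fin_val_def by (cases "F v") auto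

lemma not_domF: "v \<notin> domF F \<Longrightarrow> F v = \<infinity>"
  by (auto simp: domF_def)

lemma convex_fun_convex_on:
  assumes F: "convex_fun F" "proper_fun F"
  shows "convex_on (domF F) (fin_val F)"
proof -
  have *: "(1 - t) *\<^sub>R x + t *\<^sub>R y \<in> domF F \<and>
      fin_val F ((1 - t) *\<^sub>R x + t *\<^sub>R y) \<le> (1 - t) * fin_val F x + t * fin_val F y"
    if t: "0 \<le> t" "t \<le> 1" and xy: "x \<in> domF F" "y \<in> domF F" for x y t
  proof -
    have "F ((1 - t) *\<^sub>R x + t *\<^sub>R y) \<le> ereal (1 - t) * F x + ereal t * F y"
      using F(1) t unfolding convex_fun_def by simp
    also have "\<dots> = ereal ((1 - t) * fin_val F x + t * fin_val F y)"
      by (simp add: fin_val[OF F(2) xy(1)] fin_val[OF F(2) xy(2)])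
    finally have le: "F ((1 - t) *\<^sub>R x + t *\<^sub>R y) \<le> ereal ((1 - t) * fin_val F x + t * fin_val F y)" .
    then have d: "(1 - t) *\<^sub>R x + t *\<^sub>R y \<in> domF F"
      by (auto simp: domF_def)
    show ?thesis using le d fin_val[OF F(2) d] by simp
  qed
  have "convex (domF F)" unfolding convex_alt using * by blast
  then show ?thesis using * by (intro convex_onI) auto
qed

lemma lsc_fun_sequence_le:
  fixes F :: "'v::real_normed_vector \<Rightarrow> ereal"
  assumes F: "lsc_fun F" and x: "x \<longlonglongrightarrow> u" and b: "b \<longlonglongrightarrow> c" and le: "\<And>n. F (x n) \<le> ereal (b n)"
  shows "F u \<le> ereal c"
proof (rule dense_le)
  fix y assume "y < F u"
  then have "y < Liminf (nhds u) F" using F unfolding lsc_fun_def by (meson less_le_trans)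
  then have "\<forall>\<^sub>F n in sequentially. y < F (x n)"
    by (rule eventually_compose_filterlim[OF less_LiminfD x])
  then have "\<forall>\<^sub>F n in sequentially. y \<le> ereal (b n)"
    by eventually_elim (use le in \<open>meson less_imp_le order_trans\<close>)
  moreover have "(\<lambda>n. ereal (b n)) \<longlonglongrightarrow> ereal c" using b by simp
  ultimately show "y \<le> ereal c" by (intro tendsto_lowerbound) auto
qed

lemma convex_sublevel:
  fixes g :: "'a::real_vector \<Rightarrow> real"
  assumes g: "convex_on S g"
  shows "convex {x\<in>S. g x \<le> a}"
proof (rule convexI)
  fix x y and s t :: real
  assume x: "x \<in> {x\<in>S. g x \<le> a}" and y: "y \<in> {x\<in>S. g x \<le> a}"
    and st: "0 \<le> s" "0 \<le> t" "s + t = 1"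
  have "g (s *\<^sub>R x + t *\<^sub>R y) \<le> s * g x + t * g y"
    using g x y st by (simp add: convex_on_def)
  also have "\<dots> \<le> a" using x y st by (intro convex_bound_le) auto
  finally show "s *\<^sub>R x + t *\<^sub>R y \<in> {x\<in>S. g x \<le> a}"
    using convex_on_imp_convex[OF g] x y st by (auto simp: convex_def)
qed

lemma convex_on_square_dist:
  fixes v :: "'v::real_normed_vector"
  shows "convex_on UNIV (\<lambda>u. (norm (u - v))\<^sup>2)"
proof (rule convex_onI)
  fix t :: real and x y :: 'v assume t: "0 < t" "t < 1"
  have "norm ((1 - t) *\<^sub>R x + t *\<^sub>R y - v) = norm ((1 - t) *\<^sub>R (x - v) + t *\<^sub>R (y - v))"
    by (simp add: algebra_simps)
  also have "\<dots> \<le> (1 - t) * norm (x - v) + t * norm (y - v)"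
    using norm_triangle_ineq[of "(1 - t) *\<^sub>R (x - v)" "t *\<^sub>R (y - v)"] t by simp
  finally have "(norm ((1 - t) *\<^sub>R x + t *\<^sub>R y - v))\<^sup>2 \<le> ((1 - t) * norm (x - v) + t * norm (y - v))\<^sup>2"
    by (simp add: power_mono)
  also have "\<dots> \<le> (1 - t) * (norm (x - v))\<^sup>2 + t * (norm (y - v))\<^sup>2"
    using convex_onD[OF convex_power2, of t "norm (x - v)" "norm (y - v)"] t by simp
  finally show "(norm ((1 - t) *\<^sub>R x + t *\<^sub>R y - v))\<^sup>2
      \<le> (1 - t) * (norm (x - v))\<^sup>2 + t * (norm (y - v))\<^sup>2" .
qed simp

lemma square_le_affine_imp_bounded:
  fixes s :: real
  assumes "a > 0" "a * s\<^sup>2 \<le> b * s + c" "b \<ge> 0" "c \<ge> 0" "s \<ge> 0"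
  shows "s \<le> 1 + (b + c) / a"
proof (cases "s \<le> 1")
  case True
  have "(b + c) / a \<ge> 0" using assms by simp
  then show ?thesis using True by linarith
next
  case False
  then have "c * 1 \<le> c * s" using assms by (intro mult_left_mono) auto
  then have "(a * s) * s \<le> (b + c) * s"
    using assms(2) by (simp add: power2_eq_square algebra_simps)
  then have "a * s \<le> b + c" using False by simp
  then have "s \<le> (b + c) / a" using assms(1) by (simp add: field_simps)
  then show ?thesis by simp
qed

text \<open>If every point violated one of the finitely many inequalities, the theorem of the alternative
  would give weights \<open>l\<close>.  At the barycentre of the \<open>v i\<close>, convexity bounds the weighted sum by
  \<open>\<Sum>i j. l i * l j * h (v i) (v j)\<close>, which is nonpositive by symmetrization, minus the positive
  weighted mean of the errors \<open>e i\<close>.\<close>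

lemma minty_finite:
  fixes h :: "'v::real_vector \<Rightarrow> 'v \<Rightarrow> real"
  assumes I: "finite I" "\<And>i. i \<in> I \<Longrightarrow> v i \<in> D" "\<And>i. i \<in> I \<Longrightarrow> e i > 0"
    and mono: "\<And>x y. h x y + h y x \<le> 0"
    and conv: "\<And>x. convex_on UNIV (h x)"
    and \<phi>: "convex_on D \<phi>" and ne: "D \<noteq> {}"
  shows "\<exists>u\<in>D. \<forall>i\<in>I. h (v i) u + \<phi> u - \<phi> (v i) \<le> e i"
proof (rule ccontr)
  assume neg: "\<not> ?thesis"
  then have Ine: "I \<noteq> {}" using ne by auto
  have cD: "convex D" using \<phi> by (rule convex_on_imp_convex)
  define g where "g i u = h (v i) u + \<phi> u + (- \<phi> (v i) - e i)" for i u
  have cg: "convex_on D (g i)" if "i \<in> I" for i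
    unfolding g_def
    by (intro convex_on_add \<phi> convex_on_subset[OF conv]) (auto simp: cD convex_on_const)
  have alt: "\<exists>i\<in>I. g i u \<ge> 0" if "u \<in> D" for u
  proof -
    obtain i where "i \<in> I" "\<not> h (v i) u + \<phi> u - \<phi> (v i) \<le> e i" using neg \<open>u \<in> D\<close> by blast
    then show ?thesis unfolding g_def by (intro bexI[of _ i]) auto
  qed
  obtain l where l: "\<And>i. i \<in> I \<Longrightarrow> l i \<ge> 0" "(\<Sum>i\<in>I. l i) = 1"
    "\<And>x. x \<in> D \<Longrightarrow> (\<Sum>i\<in>I. l i * g i x) \<ge> 0"
    using finite_convex_alternative[OF I(1) Ine cD cg alt] by metis
  define x where "x = (\<Sum>i\<in>I. l i *\<^sub>R v i)"
  have xD: "x \<in> D" unfolding x_def by (rule convex_sum) (use I l cD in auto)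
  have phx: "\<phi> x \<le> (\<Sum>i\<in>I. l i * \<phi> (v i))"
    unfolding x_def by (rule convex_on_sum[OF I(1) Ine \<phi> l(2)]) (use I l in auto)
  have hx: "h y x \<le> (\<Sum>j\<in>I. l j * h y (v j))" for y
    unfolding x_def by (rule convex_on_sum[OF I(1) Ine conv l(2)]) (use l in auto)
  define S where "S = (\<Sum>i\<in>I. \<Sum>j\<in>I. l i * l j * h (v i) (v j))"
  have "S = (\<Sum>i\<in>I. \<Sum>j\<in>I. l i * l j * h (v j) (v i))"
    unfolding S_def by (subst sum.swap) (simp add: mult.commute)
  then have "2 * S = (\<Sum>i\<in>I. \<Sum>j\<in>I. l i * l j * (h (v i) (v j) + h (v j) (v i)))"
    unfolding S_def by (simp add: sum.distrib distrib_left)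
  also have "\<dots> \<le> 0"
    using l(1) mono by (intro sum_nonpos) (simp add: mult_nonneg_nonpos)
  finally have S: "S \<le> 0" by simp
  have "(\<Sum>i\<in>I. l i * h (v i) x) \<le> (\<Sum>i\<in>I. l i * (\<Sum>j\<in>I. l j * h (v i) (v j)))"
    using hx l(1) by (intro sum_mono mult_left_mono) auto
  also have "\<dots> = S" by (simp add: S_def sum_distrib_left mult.assoc)
  finally have 1: "(\<Sum>i\<in>I. l i * h (v i) x) \<le> 0" using S by simp
  obtain i0 where i0: "i0 \<in> I" "l i0 > 0"
  proof -
    have "\<exists>i\<in>I. l i \<noteq> 0" using l(2) by (metis sum.neutral zero_neq_one)
    then show thesis using that l(1) by force
  qed
  have "0 < (\<Sum>i\<in>I. l i * e i)"
  proof (rule sum_pos2[OF I(1) i0(1)])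
    show "0 < l i0 * e i0" using i0 I(3) by simp
    show "0 \<le> l i * e i" if "i \<in> I" for i using l(1)[OF that] I(3)[OF that] by simp
  qed
  moreover have "(\<Sum>i\<in>I. l i * g i x)
      = (\<Sum>i\<in>I. l i * h (v i) x) + (\<Sum>i\<in>I. l i) * \<phi> x - (\<Sum>i\<in>I. l i * \<phi> (v i)) - (\<Sum>i\<in>I. l i * e i)"
    by (simp add: g_def distrib_left right_diff_distrib sum.distrib sum_subtractf sum_distrib_right sum_negf)
  ultimately show False using l(2) l(3)[OF xD] 1 phx by simp
qed

text \<open>The bifunction \<open>h v u = \<Phi> v u + (a / 2) * \<parallel>u - v\<parallel>\<^sup>2\<close> is still monotone: in \<open>h u v + h v u\<close>
  the two halves of the quadratic term add up to the surplus in the monotonicity of \<open>\<Phi>\<close>.  The quadratic term makes the sublevel set belonging to a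
  single \<open>v\<close> bounded, as required for weak compactness.\<close>

lemma minty_equilibrium_exists:
  fixes \<Phi> :: "'v::real_normed_vector \<Rightarrow> 'v \<Rightarrow> real" and F :: "'v \<Rightarrow> ereal"
  assumes refl: "reflexive_space TYPE('v)"
    and a: "a > 0" and mono: "\<And>u v. \<Phi> u v + \<Phi> v u \<le> - a * (norm (u - v))\<^sup>2"
    and conv: "\<And>v. convex_on UNIV (\<Phi> v)" and cont: "\<And>v. continuous_on UNIV (\<Phi> v)"
    and below: "\<And>v. \<exists>C. \<forall>u. - C * norm (u - v) \<le> \<Phi> v u"
    and F: "convex_fun F" "lsc_fun F" "proper_fun F"
    and Fd: "\<And>v. ereal (- d * (1 + norm v)) \<le> F v"
  obtains u where "u \<in> domF F" "\<And>v. v \<in> domF F \<Longrightarrow> \<Phi> v u + fin_val F u \<le> fin_val F v"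
proof -
  define D where "D = domF F"
  define \<phi> where "\<phi> = fin_val F"
  have F\<phi>: "F v = ereal (\<phi> v)" if "v \<in> D" for v
    using fin_val[OF F(3)] that by (simp add: D_def \<phi>_def)
  have c\<phi>: "convex_on D \<phi>" unfolding D_def \<phi>_def by (rule convex_fun_convex_on[OF F(1,3)])
  then have cD: "convex D" by (rule convex_on_imp_convex)
  obtain v0 where v0: "v0 \<in> D" using F(3) unfolding proper_fun_def D_def by blast
  define h where "h v u = \<Phi> v u + (a / 2) * (norm (u - v))\<^sup>2" for v u
  have ch: "convex_on UNIV (h v)" for v
    unfolding h_def using a by (intro convex_on_add conv convex_on_cmul convex_on_square_dist) simp
  have conth: "continuous_on UNIV (h v)" for v
    unfolding h_def by (intro continuous_intros cont)
  have mh: "h x y + h y x \<le> 0" for x y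
    using mono[of x y] by (simp add: h_def norm_minus_commute)
  \<comment> \<open>the inequality for the test point \<open>fst i\<close>, up to the error
    \<open>snd i\<close>; the errors are needed as only approximate solutions of finite subsystems
    are available\<close>
  define M where "M i = {u\<in>D. h (fst i) u + \<phi> u + (- \<phi> (fst i)) \<le> snd i}" for i :: "'v \<times> real"
  define P where "P = D \<times> {0::real<..}"
  have M: "convex (M i) \<and> closed (M i)" for i
  proof
    show "convex (M i)" unfolding M_def
      by (intro convex_sublevel convex_on_add c\<phi> convex_on_subset[OF ch]) (auto simp: cD convex_on_const)
    show "closed (M i)"
    proof (unfold closed_sequential_limits, intro allI impI, elim conjE)
      fix x u assume x: "\<forall>n. x n \<in> M i" "x \<longlonglongrightarrow> u"
      define b where "b y = snd i + \<phi> (fst i) - h (fst i) y" for y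
      have "continuous_on UNIV b" unfolding b_def by (intro continuous_intros conth)
      then have "(\<lambda>n. b (x n)) \<longlonglongrightarrow> b u"
        using x(2) by (rule continuous_on_tendsto_compose) auto
      then have "F u \<le> ereal (b u)"
      proof (rule lsc_fun_sequence_le[OF F(2) x(2)])
        fix n have "x n \<in> M i" using x by simp
        then show "F (x n) \<le> ereal (b (x n))" using F\<phi>[of "x n"] by (simp add: M_def b_def)
      qed
      moreover from this have "u \<in> D" by (auto simp: D_def domF_def)
      ultimately show "u \<in> M i" using F\<phi>[of u] by (simp add: M_def b_def)
    qed
  qed
  have bdd: "bounded (M (v0, 1))"
  proof -
    obtain C where C: "\<And>u. - C * norm (u - v0) \<le> \<Phi> v0 u" using below by blast
    have "norm (u - v0) \<le> 1 + ((\<bar>C\<bar> + \<bar>d\<bar>) + (\<bar>d\<bar> * (1 + norm v0) + \<bar>\<phi> v0\<bar> + 1)) / (a / 2)"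
      if u: "u \<in> M (v0, 1)" for u
    proof (rule square_le_affine_imp_bounded)
      have "u \<in> D" using u by (simp add: M_def)
      then have "- (d * (1 + norm u)) \<le> \<phi> u" using Fd[of u] F\<phi>[of u] by simp
      moreover have "d * (1 + norm u) \<le> \<bar>d\<bar> * (1 + (norm v0 + norm (u - v0)))"
        using norm_triangle_ineq[of v0 "u - v0"] by (intro mult_mono) auto
      then have "d * (1 + norm u) \<le> \<bar>d\<bar> * (1 + norm v0) + \<bar>d\<bar> * norm (u - v0)"
        by (simp add: distrib_left)
      moreover have "C * norm (u - v0) \<le> \<bar>C\<bar> * norm (u - v0)" by (intro mult_right_mono) auto
      moreover have "- (C * norm (u - v0)) + a / 2 * (norm (u - v0))\<^sup>2 + \<phi> u - \<phi> v0 \<le> 1"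
        using u C[of u] by (simp add: M_def h_def)
      moreover have "\<phi> v0 \<le> \<bar>\<phi> v0\<bar>" by simp
      ultimately show "a / 2 * (norm (u - v0))\<^sup>2
          \<le> (\<bar>C\<bar> + \<bar>d\<bar>) * norm (u - v0) + (\<bar>d\<bar> * (1 + norm v0) + \<bar>\<phi> v0\<bar> + 1)"
        unfolding distrib_right by linarith
    qed (use a in auto)
    then show ?thesis
      by (intro bounded_subset[OF bounded_cball[of v0]]) (auto simp: mem_cball dist_norm norm_minus_commute)
  qed
  have fip: "\<Inter>\<D> \<noteq> {}" if fin: "finite \<D>" "\<D> \<subseteq> M ` P" for \<D>
  proof -
    obtain I where I: "finite I" "I \<subseteq> P" "\<D> = M ` I" using fin by (meson finite_subset_image)
    have "\<exists>u\<in>D. \<forall>i\<in>I. h (fst i) u + \<phi> u - \<phi> (fst i) \<le> snd i"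
    proof (rule minty_finite[OF I(1) _ _ mh ch c\<phi>])
      show "fst i \<in> D" "0 < snd i" if "i \<in> I" for i using that I(2) by (auto simp: P_def)
      show "D \<noteq> {}" using v0 by blast
    qed
    then obtain u where "u \<in> D" "\<forall>i\<in>I. h (fst i) u + \<phi> u - \<phi> (fst i) \<le> snd i" by blast
    then have "u \<in> \<Inter>\<D>" using I by (auto simp: M_def)
    then show ?thesis by blast
  qed
  have M0: "M (v0, 1) \<in> M ` P" using v0 by (auto simp: P_def)
  have MP: "convex C \<and> closed C" if "C \<in> M ` P" for C using that M by auto
  have "\<exists>u. \<forall>C\<in>M ` P. u \<in> C"
    by (rule weakly_compact_fip[OF refl MP M0 bdd fip]) blast+
  then obtain u where u: "\<And>i. i \<in> P \<Longrightarrow> u \<in> M i" by blast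
  have "\<Phi> v u + \<phi> u \<le> \<phi> v" if v: "v \<in> D" for v
  proof (rule field_le_epsilon)
    fix e :: real assume "e > 0"
    then have "u \<in> M (v, e)" using v by (intro u) (simp add: P_def)
    moreover have "0 \<le> a / 2 * (norm (u - v))\<^sup>2" using a by simp
    ultimately show "\<Phi> v u + \<phi> u \<le> \<phi> v + e" unfolding M_def h_def by simp
  qed
  moreover have "u \<in> D" using u[of "(v0, 1)"] v0 by (simp add: P_def M_def)
  ultimately show thesis using that[of u] unfolding D_def \<phi>_def by simp
qed

section \<open>The generalized directional derivative\<close>

definition dir_quot :: "('x::real_normed_vector \<Rightarrow> real) \<Rightarrow> 'x \<Rightarrow> 'x \<Rightarrow> real \<Rightarrow> real" where
  "dir_quot J z y t = (J (y + t *\<^sub>R z) - J y) / t"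

text \<open>The upper limit defining \<open>gen_dir_deriv\<close> in terms of a single radius.\<close>

lemma eventually_nhds_at_right_iff:
  fixes x :: "'x::real_normed_vector"
  shows "(\<forall>\<^sub>F (y, t) in nhds x \<times>\<^sub>F at_right (0::real). P y t) \<longleftrightarrow>
    (\<exists>d>0. \<forall>y t. norm (y - x) < d \<longrightarrow> 0 < t \<longrightarrow> t < d \<longrightarrow> P y t)"
proof
  assume "\<forall>\<^sub>F (y, t) in nhds x \<times>\<^sub>F at_right (0::real). P y t"
  then obtain Q R where Q: "eventually Q (nhds x)" and R: "eventually R (at_right (0::real))"
    and QR: "\<And>y t. Q y \<Longrightarrow> R t \<Longrightarrow> P y t"
    unfolding eventually_prod_filter by auto
  obtain d where d: "d > 0" "\<And>y. dist y x < d \<Longrightarrow> Q y"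
    using Q unfolding eventually_nhds_metric by blast
  obtain e where e: "e > 0" "\<And>t. 0 < t \<Longrightarrow> t < e \<Longrightarrow> R t"
    using R unfolding eventually_at_right_field by auto
  show "\<exists>d>0. \<forall>y t. norm (y - x) < d \<longrightarrow> 0 < t \<longrightarrow> t < d \<longrightarrow> P y t"
    using d e QR by (intro exI[of _ "min d e"]) (auto simp: dist_norm)
next
  assume "\<exists>d>0. \<forall>y t. norm (y - x) < d \<longrightarrow> 0 < t \<longrightarrow> t < d \<longrightarrow> P y t"
  then obtain d where d: "d > 0" "\<And>y t. norm (y - x) < d \<Longrightarrow> 0 < t \<Longrightarrow> t < d \<Longrightarrow> P y t" by blast
  have "eventually (\<lambda>y. norm (y - x) < d) (nhds x)"
    using d(1) unfolding eventually_nhds_metric by (auto simp: dist_norm)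
  moreover have "eventually (\<lambda>t. 0 < t \<and> t < d) (at_right (0::real))"
    using d(1) unfolding eventually_at_right_field by auto
  ultimately show "\<forall>\<^sub>F (y, t) in nhds x \<times>\<^sub>F at_right (0::real). P y t"
    unfolding eventually_prod_filter using d(2) by fastforce
qed

lemma gen_dir_deriv_leI:
  assumes "d > 0" "\<And>y t. norm (y - x) < d \<Longrightarrow> 0 < t \<Longrightarrow> t < d \<Longrightarrow> dir_quot J z y t \<le> a"
  shows "gen_dir_deriv J x z \<le> ereal a"
  unfolding gen_dir_deriv_def
proof (rule Limsup_bounded)
  have "\<forall>\<^sub>F (y, t) in nhds x \<times>\<^sub>F at_right 0. dir_quot J z y t \<le> a"
    unfolding eventually_nhds_at_right_iff using assms by blast
  then show "\<forall>\<^sub>F p in nhds x \<times>\<^sub>F at_right 0.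
      (case p of (y, t) \<Rightarrow> ereal ((J (y + t *\<^sub>R z) - J y) / t)) \<le> ereal a"
    by eventually_elim (auto simp: dir_quot_def)
qed

lemma gen_dir_deriv_geI:
  assumes "d > 0" "\<And>y t. norm (y - x) < d \<Longrightarrow> 0 < t \<Longrightarrow> t < d \<Longrightarrow> a \<le> dir_quot J z y t"
  shows "ereal a \<le> gen_dir_deriv J x z"
  unfolding gen_dir_deriv_def
proof (rule order_trans[OF Liminf_bounded Liminf_le_Limsup])
  have "\<forall>\<^sub>F (y, t) in nhds x \<times>\<^sub>F at_right 0. a \<le> dir_quot J z y t"
    unfolding eventually_nhds_at_right_iff using assms by blast
  then show "\<forall>\<^sub>F p in nhds x \<times>\<^sub>F at_right 0.
      ereal a \<le> (case p of (y, t) \<Rightarrow> ereal ((J (y + t *\<^sub>R z) - J y) / t))"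
    by eventually_elim (auto simp: dir_quot_def)
  show "nhds x \<times>\<^sub>F at_right (0::real) \<noteq> bot"
    by (simp add: prod_filter_eq_bot)
qed

lemma gen_dir_deriv_lessD:
  assumes "gen_dir_deriv J x z < ereal a"
  obtains d where "d > 0" "\<And>y t. norm (y - x) < d \<Longrightarrow> 0 < t \<Longrightarrow> t < d \<Longrightarrow> dir_quot J z y t < a"
proof -
  have "\<forall>\<^sub>F p in nhds x \<times>\<^sub>F at_right 0.
      (case p of (y, t) \<Rightarrow> ereal ((J (y + t *\<^sub>R z) - J y) / t)) < ereal a"
    using assms unfolding gen_dir_deriv_def by (rule Limsup_lessD)
  then have "\<forall>\<^sub>F (y, t) in nhds x \<times>\<^sub>F at_right 0. dir_quot J z y t < a"
    by eventually_elim (auto simp: dir_quot_def)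
  then show thesis unfolding eventually_nhds_at_right_iff using that by blast
qed

text \<open>Agrees with \<open>gen_dir_deriv\<close> for locally Lipschitz \<open>J\<close>, where the infinite values, converted to
  \<open>0\<close>, do not occur.\<close>

definition clarke :: "('x::real_normed_vector \<Rightarrow> real) \<Rightarrow> 'x \<Rightarrow> 'x \<Rightarrow> real" where
  "clarke J x z = real_of_ereal (gen_dir_deriv J x z)"

text \<open>All difference quotients taken inside the ball are bounded by \<open>L * norm z\<close>.  The bound holds
  at every point \<open>y\<close> of the ball with the same constant, which upper semicontinuity in both
  arguments relies on.\<close>

lemma lipschitz_clarke_bounds:
  assumes L: "L-lipschitz_on (ball x r) J" and y: "norm (y - x) < r"
  shows "gen_dir_deriv J y z = ereal (clarke J y z)" and "\<bar>clarke J y z\<bar> \<le> L * norm z"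
proof -
  \<comment> \<open>small enough for \<open>w\<close> and \<open>w + t z\<close> to stay in the
    ball\<close>
  define d where "d = (r - norm (y - x)) / (1 + norm z)"
  have d: "d > 0" using y by (simp add: d_def add_pos_nonneg)
  have q: "\<bar>dir_quot J z w t\<bar> \<le> L * norm z" if w: "norm (w - y) < d" and t: "0 < t" "t < d" for w t
  proof -
    have 1: "norm (w - y) + t * norm z < r - norm (y - x)"
    proof -
      have "norm (w - y) + t * norm z < d + d * norm z"
        using w t by (intro add_less_le_mono mult_right_mono) auto
      also have "\<dots> = r - norm (y - x)"
        by (simp add: d_def field_simps add_nonneg_eq_0_iff) 
      finally show ?thesis .
    qed
    have "norm (w - x) \<le> norm (w - y) + norm (y - x)"
      using norm_triangle_ineq[of "w - y" "y - x"] by simp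
    moreover have "norm (w + t *\<^sub>R z - x) \<le> norm (w - x) + t * norm z"
      using norm_triangle_ineq[of "w - x" "t *\<^sub>R z"] t by (simp add: algebra_simps)
    moreover have "0 \<le> t * norm z" using t by simp
    ultimately have "w \<in> ball x r" "w + t *\<^sub>R z \<in> ball x r"
      using 1 by (auto simp: dist_norm norm_minus_commute)
    then have "dist (J (w + t *\<^sub>R z)) (J w) \<le> L * dist (w + t *\<^sub>R z) w"
      by (intro lipschitz_onD[OF L])
    then have "\<bar>J (w + t *\<^sub>R z) - J w\<bar> \<le> L * (t * norm z)"
      using t by (simp add: dist_norm)
    then show ?thesis using t by (simp add: dir_quot_def abs_divide pos_divide_le_eq mult_ac)
  qed
  have up: "gen_dir_deriv J y z \<le> ereal (L * norm z)"
    using q by (intro gen_dir_deriv_leI[OF d]) (auto simp: abs_le_iff)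
  have lo: "ereal (- (L * norm z)) \<le> gen_dir_deriv J y z"
    using q by (intro gen_dir_deriv_geI[OF d]) (smt (verit) abs_le_iff)
  show "gen_dir_deriv J y z = ereal (clarke J y z)"
    unfolding clarke_def using up lo by (cases "gen_dir_deriv J y z") auto
  then show "\<bar>clarke J y z\<bar> \<le> L * norm z"
    using up lo by (simp add: abs_le_iff)
qed

context
  fixes J :: "'x::real_normed_vector \<Rightarrow> real"
  assumes J: "locally_lipschitz J"
begin

lemma gen_dir_deriv_eq_clarke: "gen_dir_deriv J x z = ereal (clarke J x z)"
proof -
  obtain r L where "r > 0" "L-lipschitz_on (ball x r) J"
    using J unfolding locally_lipschitz_def by blast
  then show ?thesis using lipschitz_clarke_bounds(1)[of L x r J x z] by simp
qed

lemma clarke_locally_bounded: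
  obtains r L where "r > 0" "L \<ge> 0" "\<And>y z. norm (y - x) < r \<Longrightarrow> \<bar>clarke J y z\<bar> \<le> L * norm z"
proof -
  obtain r L where r: "r > 0" "L-lipschitz_on (ball x r) J"
    using J unfolding locally_lipschitz_def by blast
  then show thesis using that lipschitz_clarke_bounds(2)[OF r(2)] lipschitz_on_nonneg by blast
qed

lemma clarke_lessD:
  assumes "clarke J x z < a"
  obtains d where "d > 0" "\<And>y t. norm (y - x) < d \<Longrightarrow> 0 < t \<Longrightarrow> t < d \<Longrightarrow> dir_quot J z y t < a"
  using gen_dir_deriv_lessD[of J x z a] assms by (auto simp: gen_dir_deriv_eq_clarke)

lemma clarke_leI:
  assumes "d > 0" "\<And>y t. norm (y - x) < d \<Longrightarrow> 0 < t \<Longrightarrow> t < d \<Longrightarrow> dir_quot J z y t \<le> a"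
  shows "clarke J x z \<le> a"
  using gen_dir_deriv_leI[of d x J z a] assms by (simp add: gen_dir_deriv_eq_clarke)

lemma clarke_zero [simp]: "clarke J x 0 = 0"
  using clarke_locally_bounded[of x] by (metis abs_le_zero_iff cancel_comm_monoid_add_class.diff_cancel mult_zero_right norm_zero)

text \<open>The quotient at \<open>y\<close> in direction \<open>z + w\<close> is the sum of the quotient at \<open>y\<close> in direction \<open>z\<close> and
  the quotient at the moved base point \<open>y + t z\<close> in direction \<open>w\<close>; the upper limit over all
  base points near \<open>x\<close> covers both.\<close>

lemma clarke_add: "clarke J x (z + w) \<le> clarke J x z + clarke J x w"
proof (rule field_le_epsilon)
  fix e :: real assume e: "e > 0"
  obtain d1 where d1: "d1 > 0"
    "\<And>y t. norm (y - x) < d1 \<Longrightarrow> 0 < t \<Longrightarrow> t < d1 \<Longrightarrow> dir_quot J z y t < clarke J x z + e / 2"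
    using clarke_lessD[of x z "clarke J x z + e / 2"] e by auto
  obtain d2 where d2: "d2 > 0"
    "\<And>y t. norm (y - x) < d2 \<Longrightarrow> 0 < t \<Longrightarrow> t < d2 \<Longrightarrow> dir_quot J w y t < clarke J x w + e / 2"
    using clarke_lessD[of x w "clarke J x w + e / 2"] e by auto
  define d where "d = min d1 (d2 / (1 + norm z))"
  have d: "d > 0" "d \<le> d1" "d + d * norm z \<le> d2"
  proof -
    show "d > 0" using d1 d2 by (simp add: d_def add_pos_nonneg)
    show "d \<le> d1" by (simp add: d_def)
    have "d \<le> d2 / (1 + norm z)" by (simp add: d_def)
    then show "d + d * norm z \<le> d2"
      by (simp add: pos_le_divide_eq add_pos_nonneg algebra_simps)
  qed
  show "clarke J x (z + w) \<le> clarke J x z + clarke J x w + e"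
  proof (rule clarke_leI[OF d(1)])
    fix y and t :: real assume y: "norm (y - x) < d" and t: "0 < t" "t < d"
    have "norm (y + t *\<^sub>R z - x) \<le> norm (y - x) + t * norm z"
      using norm_triangle_ineq[of "y - x" "t *\<^sub>R z"] t by (simp add: algebra_simps)
    also have "\<dots> < d + d * norm z"
      using y t by (intro add_less_le_mono mult_right_mono) auto
    finally have n: "norm (y + t *\<^sub>R z - x) < d2" using d by simp
    have "d \<le> d2" using d by (smt (verit) mult_nonneg_nonneg norm_ge_zero)
    then have "dir_quot J w (y + t *\<^sub>R z) t < clarke J x w + e / 2"
      using n t by (intro d2(2)) auto
    moreover have "dir_quot J z y t < clarke J x z + e / 2"
      using y t d by (intro d1(2)) auto
    moreover have "dir_quot J (z + w) y t = dir_quot J w (y + t *\<^sub>R z) t + dir_quot J z y t"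
      by (simp add: dir_quot_def diff_divide_distrib algebra_simps)
    ultimately show "dir_quot J (z + w) y t \<le> clarke J x z + clarke J x w + e" by simp
  qed
qed

lemma clarke_scale_le: 
  assumes s: "s > 0" 
  shows "clarke J x (s *\<^sub>R z) \<le> s * clarke J x z"
proof -
  have "clarke J x (s *\<^sub>R z) / s \<le> clarke J x z"
  proof (rule field_le_epsilon)
    fix e :: real assume e: "e > 0"
    obtain d where d: "d > 0"
      "\<And>y t. norm (y - x) < d \<Longrightarrow> 0 < t \<Longrightarrow> t < d \<Longrightarrow> dir_quot J z y t < clarke J x z + e"
      using clarke_lessD[of x z "clarke J x z + e"] e by auto
    have "clarke J x (s *\<^sub>R z) \<le> s * (clarke J x z + e)"
    proof (rule clarke_leI[of "min d (d / s)"])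
      fix y and t :: real assume y: "norm (y - x) < min d (d / s)" "0 < t" "t < min d (d / s)"
      then have "dir_quot J z y (t * s) < clarke J x z + e"
        using s by (intro d(2)) (auto simp: field_simps)
      then have "s * dir_quot J z y (t * s) \<le> s * (clarke J x z + e)"
        using s by simp
      moreover have "s * dir_quot J z y (t * s) = dir_quot J (s *\<^sub>R z) y t"
        using s by (simp add: dir_quot_def)
      ultimately show "dir_quot J (s *\<^sub>R z) y t \<le> s * (clarke J x z + e)" by simp
    qed (use d s in auto)
    then show "clarke J x (s *\<^sub>R z) / s \<le> clarke J x z + e"
      using s by (simp add: field_simps)
  qed
  then show ?thesis using s by (simp add: field_simps)
qed

lemma clarke_convex: 
  assumes "0 \<le> s" "0 \<le> t"
  shows "clarke J x (s *\<^sub>R z + t *\<^sub>R w) \<le> s * clarke J x z + t * clarke J x w"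
proof -
  have "clarke J x (s *\<^sub>R z) \<le> s * clarke J x z" if "0 \<le> s" for s z
    using clarke_scale_le[of s x z] that by (cases "s = 0") auto
  then show ?thesis using clarke_add[of x "s *\<^sub>R z" "t *\<^sub>R w"] assms by (smt (verit))
qed

lemma clarke_minus: "- clarke J x z \<le> clarke J x (- z)"
  using clarke_add[of x z "- z"] by simp

lemma clarke_continuous: "continuous_on UNIV (clarke J x)"
proof -
  obtain r L where r: "r > 0" "L \<ge> 0" "\<And>y z. norm (y - x) < r \<Longrightarrow> \<bar>clarke J y z\<bar> \<le> L * norm z"
    using clarke_locally_bounded[of x] by metis
  have le: "clarke J x z - clarke J x w \<le> L * norm (z - w)" for z w
    using clarke_add[of x w "z - w"] r(3)[of x "z - w"] r(1) by (simp add: abs_le_iff)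
  have "L-lipschitz_on UNIV (clarke J x)"
  proof (rule lipschitz_onI)
    fix z w show "dist (clarke J x z) (clarke J x w) \<le> L * dist z w"
      using le[of z w] le[of w z] by (simp add: dist_norm abs_le_iff norm_minus_commute)
  qed (rule r(2))
  then show ?thesis by (rule lipschitz_on_continuous_on)
qed

text \<open>A bound on the quotients near \<open>x\<close> is a bound on the quotients near every point close to \<open>x\<close>.
  The change of direction is absorbed by the locally uniform Lipschitz bound.\<close>

lemma clarke_upper_semicontinuous:
  assumes xn: "xn \<longlonglongrightarrow> x" and zn: "zn \<longlonglongrightarrow> z" and a: "clarke J x z < a"
  shows "\<forall>\<^sub>F n in sequentially. clarke J (xn n) (zn n) < a"
proof -
  obtain b where b: "clarke J x z < b" "b < a" using a dense by blast
  obtain d where d: "d > 0"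
    "\<And>y t. norm (y - x) < d \<Longrightarrow> 0 < t \<Longrightarrow> t < d \<Longrightarrow> dir_quot J z y t < b"
    using clarke_lessD[OF b(1)] by blast
  obtain r L where r: "r > 0" "\<And>y z. norm (y - x) < r \<Longrightarrow> \<bar>clarke J y z\<bar> \<le> L * norm z"
    using clarke_locally_bounded[of x] by metis
  have "\<forall>\<^sub>F n in sequentially. norm (xn n - x) < min r (d / 2)"
    using tendstoD[OF xn, of "min r (d / 2)"] d r by (simp add: dist_norm)
  moreover have "(\<lambda>n. b + L * norm (zn n - z)) \<longlonglongrightarrow> b + L * 0"
    using zn by (intro tendsto_intros) (simp add: LIM_zero_iff tendsto_norm_zero)
  then have "\<forall>\<^sub>F n in sequentially. b + L * norm (zn n - z) < a"
    using b by (intro order_tendstoD) auto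
  ultimately show ?thesis
  proof eventually_elim
    case (elim n)
    have "clarke J (xn n) z \<le> b"
    proof (rule clarke_leI[of "d / 2"])
      fix y and t :: real assume y: "norm (y - xn n) < d / 2" "0 < t" "t < d / 2"
      have "norm (y - x) \<le> norm (y - xn n) + norm (xn n - x)"
        using norm_triangle_ineq[of "y - xn n" "xn n - x"] by simp
      then show "dir_quot J z y t \<le> b"
        using y elim d by (intro less_imp_le d(2)) auto
    qed (use d in simp)
    moreover have "clarke J (xn n) (zn n) \<le> clarke J (xn n) z + clarke J (xn n) (zn n - z)"
      using clarke_add[of "xn n" z "zn n - z"] by simp
    moreover have "clarke J (xn n) (zn n - z) \<le> L * norm (zn n - z)"
      using r(2)[of "xn n" "zn n - z"] elim by (simp add: abs_le_iff)
    ultimately show ?case using elim by simp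
  qed
qed

end

section \<open>Hemivariational inequalities\<close>

locale hemivariational_inequality =
  fixes A :: "'v::real_normed_vector \<Rightarrow> 'v \<Rightarrow>\<^sub>L real"
    and \<gamma> :: "'v \<Rightarrow>\<^sub>L 'x::real_normed_vector"
    and J :: "'x \<Rightarrow> real"
    and cA cJ :: real
  assumes A_cont: "continuous_on UNIV A"
    and A_mono: "strongly_monotone cA A"
    and J_lip: "locally_lipschitz J"
    and J_relaxed: "\<And>y z. gen_dir_deriv J y (z - y) + gen_dir_deriv J z (y - z)
                  \<le> ereal (cJ * (norm (y - z))\<^sup>2)"
    and cJ_pos: "cJ > 0"
    and small: "cJ * (norm \<gamma>)\<^sup>2 < cA"
begin

definition \<Phi> :: "'v \<Rightarrow> 'v \<Rightarrow> real" where
  "\<Phi> u v = blinfun_apply (A u) (v - u) + clarke J (blinfun_apply \<gamma> u) (blinfun_apply \<gamma> (v - u))"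

definition gap :: real where "gap = cA - cJ * (norm \<gamma>)\<^sup>2"

lemma gap_pos: "gap > 0" using small by (simp add: gap_def)

lemma A_tendsto: "x \<longlonglongrightarrow> u \<Longrightarrow> (\<lambda>n. A (x n)) \<longlonglongrightarrow> A u"
  by (rule continuous_on_tendsto_compose[OF A_cont]) auto

lemma A_strongly_monotone:
  "cA * (norm (u - v))\<^sup>2 \<le> blinfun_apply (A u) (u - v) - blinfun_apply (A v) (u - v)"
  using A_mono unfolding strongly_monotone_def by (simp add: blinfun.diff_left)

lemma clarke_relaxed:
  "clarke J (blinfun_apply \<gamma> u) (blinfun_apply \<gamma> (v - u)) + clarke J (blinfun_apply \<gamma> v) (blinfun_apply \<gamma> (u - v))
     \<le> cJ * (norm \<gamma>)\<^sup>2 * (norm (u - v))\<^sup>2"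
proof -
  have "clarke J (blinfun_apply \<gamma> u) (blinfun_apply \<gamma> (v - u)) + clarke J (blinfun_apply \<gamma> v) (blinfun_apply \<gamma> (u - v))
     \<le> cJ * (norm (blinfun_apply \<gamma> (u - v)))\<^sup>2"
    using J_relaxed[of "blinfun_apply \<gamma> u" "blinfun_apply \<gamma> v"]
    by (simp add: gen_dir_deriv_eq_clarke[OF J_lip] blinfun.diff_right)
  also have "\<dots> \<le> cJ * (norm \<gamma> * norm (u - v))\<^sup>2"
    using cJ_pos by (intro mult_left_mono power_mono norm_blinfun) auto
  finally show ?thesis by (simp add: power_mult_distrib mult.assoc)
qed

lemma \<Phi>_strongly_monotone: "\<Phi> u v + \<Phi> v u \<le> - gap * (norm (u - v))\<^sup>2"
proof -
  have "blinfun_apply (A u) (v - u) = - blinfun_apply (A u) (u - v)"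
    by (simp add: blinfun.diff_right)
  then show ?thesis
    using A_strongly_monotone[of u v] clarke_relaxed[of u v]
    by (simp add: \<Phi>_def gap_def algebra_simps)
qed

lemma \<Phi>_convex: "convex_on UNIV (\<Phi> v)"
proof (rule convex_onI)
  fix t :: real and x y :: 'v assume t: "0 < t" "t < 1"
  have eq: "(1 - t) *\<^sub>R x + t *\<^sub>R y - v = (1 - t) *\<^sub>R (x - v) + t *\<^sub>R (y - v)"
    by (simp add: algebra_simps)
  have "clarke J (blinfun_apply \<gamma> v) (blinfun_apply \<gamma> ((1 - t) *\<^sub>R (x - v) + t *\<^sub>R (y - v)))
      \<le> (1 - t) * clarke J (blinfun_apply \<gamma> v) (blinfun_apply \<gamma> (x - v))
        + t * clarke J (blinfun_apply \<gamma> v) (blinfun_apply \<gamma> (y - v))"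
    unfolding blinfun.add_right blinfun.scaleR_right using t by (intro clarke_convex[OF J_lip]) auto
  then show "\<Phi> v ((1 - t) *\<^sub>R x + t *\<^sub>R y) \<le> (1 - t) * \<Phi> v x + t * \<Phi> v y"
    unfolding \<Phi>_def eq by (simp add: blinfun.add_right blinfun.scaleR_right distrib_left)
qed simp

lemma \<Phi>_continuous: "continuous_on UNIV (\<Phi> v)"
proof -
  have "continuous_on UNIV (\<lambda>u. clarke J (blinfun_apply \<gamma> v) (blinfun_apply \<gamma> (u - v)))"
    by (rule continuous_on_compose2[OF clarke_continuous[OF J_lip]]) (auto intro!: continuous_intros)
  then show ?thesis unfolding \<Phi>_def by (intro continuous_intros)
qed

text \<open>The constant is uniform along the convergent sequence \<open>w\<close>, since \<open>A\<close> is continuous and \<open>J\<close> is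
  Lipschitz near \<open>\<gamma> u\<close>.\<close>

lemma \<Phi>_bounded_below:
  assumes w: "w \<longlonglongrightarrow> u"
  shows "\<exists>C\<ge>0. \<forall>\<^sub>F n in sequentially. \<forall>v. - C * norm (v - w n) \<le> \<Phi> (w n) v"
proof -
  obtain r L where r: "r > 0" "L \<ge> 0"
    "\<And>y z. norm (y - blinfun_apply \<gamma> u) < r \<Longrightarrow> \<bar>clarke J y z\<bar> \<le> L * norm z"
    using clarke_locally_bounded[OF J_lip, of "blinfun_apply \<gamma> u"] by metis
  define C where "C = (norm (A u) + 1) + L * norm \<gamma>"
  have "\<forall>\<^sub>F n in sequentially. norm (A (w n)) < norm (A u) + 1"
    by (rule order_tendstoD(2)[OF tendsto_norm[OF A_tendsto[OF w]]]) simp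
  moreover have "(\<lambda>n. blinfun_apply \<gamma> (w n)) \<longlonglongrightarrow> blinfun_apply \<gamma> u"
    by (intro tendsto_intros w)
  then have "\<forall>\<^sub>F n in sequentially. dist (blinfun_apply \<gamma> (w n)) (blinfun_apply \<gamma> u) < r"
    using r(1) by (rule tendstoD)
  ultimately have "\<forall>\<^sub>F n in sequentially. \<forall>v. - C * norm (v - w n) \<le> \<Phi> (w n) v"
  proof eventually_elim
    case (elim n)
    show ?case
    proof
      fix v
      have "\<bar>blinfun_apply (A (w n)) (v - w n)\<bar> \<le> norm (A (w n)) * norm (v - w n)"
        using norm_blinfun[of "A (w n)" "v - w n"] by simp
      also have "\<dots> \<le> (norm (A u) + 1) * norm (v - w n)"
        using elim by (intro mult_right_mono) auto
      finally have 1: "\<bar>blinfun_apply (A (w n)) (v - w n)\<bar> \<le> (norm (A u) + 1) * norm (v - w n)" .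
      have "\<bar>clarke J (blinfun_apply \<gamma> (w n)) (blinfun_apply \<gamma> (v - w n))\<bar> \<le> L * norm (blinfun_apply \<gamma> (v - w n))"
        using elim by (intro r(3)) (simp add: dist_norm)
      also have "\<dots> \<le> L * (norm \<gamma> * norm (v - w n))"
        using r(2) by (intro mult_left_mono norm_blinfun)
      finally have 2: "\<bar>clarke J (blinfun_apply \<gamma> (w n)) (blinfun_apply \<gamma> (v - w n))\<bar>
          \<le> L * norm \<gamma> * norm (v - w n)" by (simp add: mult.assoc)
      show "- C * norm (v - w n) \<le> \<Phi> (w n) v"
        using 1 2 unfolding \<Phi>_def C_def minus_mult_left[symmetric] distrib_right by linarith
    qed
  qed
  moreover have "C \<ge> 0" using r(2) by (simp add: C_def)
  ultimately show ?thesis by blast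
qed

text \<open>Test points outside \<open>domF F\<close> make the left-hand side of the inequality infinite, so the problem
  is one about real numbers.\<close>

lemma hvi_solution_iff:
  assumes F: "proper_fun F"
  shows "hvi_solution A \<gamma> J F u \<longleftrightarrow>
    u \<in> domF F \<and> (\<forall>v\<in>domF F. fin_val F u \<le> \<Phi> u v + fin_val F v)"
proof -
  have "0 \<le> ereal (blinfun_apply (A u) (v - u))
          + gen_dir_deriv J (blinfun_apply \<gamma> u) (blinfun_apply \<gamma> v - blinfun_apply \<gamma> u) + F v - F u
      \<longleftrightarrow> (v \<in> domF F \<longrightarrow> fin_val F u \<le> \<Phi> u v + fin_val F v)" if u: "u \<in> domF F" for v
  proof (cases "v \<in> domF F")
    case True
    then show ?thesis
      by (simp add: fin_val[OF F u] fin_val[OF F True] gen_dir_deriv_eq_clarke[OF J_lip] \<Phi>_def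
          blinfun.diff_right zero_ereal_def)
  next
    case False
    then show ?thesis
      by (simp add: fin_val[OF F u] not_domF[OF False] gen_dir_deriv_eq_clarke[OF J_lip])
  qed
  then show ?thesis unfolding hvi_solution_def by blast
qed

lemma hvi_solution_unique:
  assumes F: "proper_fun F" and u: "hvi_solution A \<gamma> J F u" and v: "hvi_solution A \<gamma> J F v"
  shows "u = v"
proof -
  have "0 \<le> \<Phi> u v + \<Phi> v u"
    using u v unfolding hvi_solution_iff[OF F] by fastforce
  then have "gap * (norm (u - v))\<^sup>2 \<le> 0" using \<Phi>_strongly_monotone[of u v] by simp
  then show ?thesis using gap_pos by (simp add: mult_le_0_iff)
qed

text \<open>Minty's trick: the condition is used at points \<open>u + t (v - u)\<close>, divided by \<open>t\<close>, and \<open>t\<close> tends to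
  \<open>0\<close>.  The derivative of \<open>J\<close> appears in the direction of \<open>u - v\<close> with the wrong sign, but
  \<open>- J\<^sup>0(y; z) \<le> J\<^sup>0(y; - z)\<close> turns it around, after which upper semicontinuity suffices.\<close>

lemma minty_imp_hvi_solution:
  assumes F: "convex_fun F" "proper_fun F" and u: "u \<in> domF F"
    and minty: "\<And>v. v \<in> domF F \<Longrightarrow> \<Phi> v u + fin_val F u \<le> fin_val F v"
  shows "hvi_solution A \<gamma> J F u"
  unfolding hvi_solution_iff[OF F(2)]
proof (intro conjI ballI u)
  fix v assume v: "v \<in> domF F"
  define t where "t n = inverse (real (Suc n))" for n
  define x where "x n = u + t n *\<^sub>R (v - u)" for n
  define G where "G n = blinfun_apply (A (x n)) (v - u)
      + clarke J (blinfun_apply \<gamma> (x n)) (blinfun_apply \<gamma> (v - u)) + fin_val F v - fin_val F u" for n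
  have t: "0 < t n" "t n \<le> 1" for n by (auto simp: t_def divide_simps)
  have xeq: "x n = (1 - t n) *\<^sub>R u + t n *\<^sub>R v" for n by (simp add: x_def algebra_simps)
  have cF: "convex_on (domF F) (fin_val F)" by (rule convex_fun_convex_on[OF F])
  have pos: "0 \<le> G n" for n
  proof -
    let ?y = "blinfun_apply \<gamma> (x n)" and ?z = "blinfun_apply \<gamma> (v - u)"
    have xD: "x n \<in> domF F"
      unfolding xeq using convex_on_imp_convex[OF cF] u v t[of n] by (auto simp: convex_alt)
    have d: "u - x n = - (t n *\<^sub>R (v - u))" by (simp add: x_def)
    have "fin_val F (x n) \<le> (1 - t n) * fin_val F u + t n * fin_val F v"
      unfolding xeq using t[of n] u v by (intro convex_onD[OF cF]) auto
    moreover have "\<Phi> (x n) u = - (t n * blinfun_apply (A (x n)) (v - u)) + clarke J ?y (- (t n *\<^sub>R ?z))"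
      unfolding \<Phi>_def d by (simp add: blinfun.minus_right blinfun.scaleR_right)
    moreover have "- clarke J ?y (t n *\<^sub>R ?z) \<le> clarke J ?y (- (t n *\<^sub>R ?z))"
      by (rule clarke_minus[OF J_lip])
    moreover have "clarke J ?y (t n *\<^sub>R ?z) \<le> t n * clarke J ?y ?z"
      using t by (intro clarke_scale_le[OF J_lip]) auto
    moreover have "t n * G n = t n * blinfun_apply (A (x n)) (v - u) + t n * clarke J ?y ?z
        + t n * fin_val F v - t n * fin_val F u"
      by (simp add: G_def algebra_simps)
    ultimately have "0 \<le> t n * G n"
      using minty[OF xD] by (simp add: left_diff_distrib)
    then show ?thesis using t(1)[of n] by (simp add: zero_le_mult_iff)
  qed
  have "t \<longlonglongrightarrow> 0" unfolding t_def by (rule LIMSEQ_inverse_real_of_nat)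
  then have "x \<longlonglongrightarrow> u + 0 *\<^sub>R (v - u)" unfolding x_def by (intro tendsto_intros)
  then have x: "x \<longlonglongrightarrow> u" by simp
  show "fin_val F u \<le> \<Phi> u v + fin_val F v"
  proof (rule field_le_epsilon)
    fix e :: real assume e: "e > 0"
    let ?z = "blinfun_apply \<gamma> (v - u)"
    have "(\<lambda>n. blinfun_apply (A (x n)) (v - u)) \<longlonglongrightarrow> blinfun_apply (A u) (v - u)"
      by (intro tendsto_intros A_tendsto x)
    then have "\<forall>\<^sub>F n in sequentially. blinfun_apply (A (x n)) (v - u) < blinfun_apply (A u) (v - u) + e / 2"
      using e by (intro order_tendstoD) auto
    moreover have "\<forall>\<^sub>F n in sequentially.
        clarke J (blinfun_apply \<gamma> (x n)) ?z < clarke J (blinfun_apply \<gamma> u) ?z + e / 2"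
      using e by (intro clarke_upper_semicontinuous[OF J_lip, of _ "blinfun_apply \<gamma> u" _ ?z] tendsto_intros x) auto
    ultimately have "\<forall>\<^sub>F n in sequentially. fin_val F u \<le> \<Phi> u v + fin_val F v + e"
    proof eventually_elim
      case (elim n)
      then show ?case using pos[of n] by (simp add: G_def \<Phi>_def)
    qed
    then show "fin_val F u \<le> \<Phi> u v + fin_val F v + e" by simp
  qed
qed

lemma hvi_sol_solution:
  assumes refl: "reflexive_space TYPE('v)"
    and F: "convex_fun F" "lsc_fun F" "proper_fun F"
    and Fd: "\<And>v. ereal (- d * (1 + norm v)) \<le> F v"
  shows "hvi_solution A \<gamma> J F (hvi_sol A \<gamma> J F)"
proof -
  have below: "\<exists>C. \<forall>u. - C * norm (u - v) \<le> \<Phi> v u" for v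
    using \<Phi>_bounded_below[of "\<lambda>_. v" v] by auto
  obtain u where "u \<in> domF F" "\<And>v. v \<in> domF F \<Longrightarrow> \<Phi> v u + fin_val F u \<le> fin_val F v"
    using minty_equilibrium_exists[OF refl gap_pos \<Phi>_strongly_monotone \<Phi>_convex \<Phi>_continuous below F Fd]
    by metis
  then have sol: "hvi_solution A \<gamma> J F u" by (rule minty_imp_hvi_solution[OF F(1,3)])
  show ?thesis
    unfolding hvi_sol_def by (rule theI[where P = "hvi_solution A \<gamma> J F", OF sol]) (rule hvi_solution_unique[OF F(3) _ sol])
qed

text \<open>Testing the solution \<open>v\<close> with \<open>w\<close>, strong monotonicity bounds \<open>gap * \<parallel>v - w\<parallel>\<^sup>2\<close> by an affine
  function of \<open>\<parallel>v - w\<parallel>\<close>.\<close>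

lemma hvi_solution_bound:
  assumes F: "proper_fun F" and v: "hvi_solution A \<gamma> J F v" and w: "w \<in> domF F"
    and C: "C \<ge> 0" "- C * norm (v - w) \<le> \<Phi> w v"
    and d: "d \<ge> 0" "ereal (- d * (1 + norm v)) \<le> F v"
  shows "norm (v - w) \<le> 1 + ((C + d) + (d * (1 + norm w) + \<bar>fin_val F w\<bar>)) / gap"
proof (rule square_le_affine_imp_bounded[OF gap_pos])
  have vD: "v \<in> domF F" and le: "fin_val F v \<le> \<Phi> v w + fin_val F w"
    using v w unfolding hvi_solution_iff[OF F] by auto
  have "- (d * (1 + norm v)) \<le> fin_val F v" using d(2) fin_val[OF F vD] by simp
  moreover have "d * (1 + norm v) \<le> d * (1 + norm w) + d * norm (v - w)"
    using d(1) norm_triangle_ineq[of w "v - w"]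
    by (simp add: distrib_left[symmetric] mult_left_mono)
  moreover have "- (C * norm (v - w)) \<le> \<Phi> w v" using C(2) by simp
  moreover have "gap * (norm (v - w))\<^sup>2 \<le> - \<Phi> v w - \<Phi> w v"
    using \<Phi>_strongly_monotone[of v w] by simp
  ultimately show "gap * (norm (v - w))\<^sup>2 \<le> (C + d) * norm (v - w) + (d * (1 + norm w) + \<bar>fin_val F w\<bar>)"
    using le unfolding distrib_right by linarith
qed (use C d in auto)

lemma hvi_solutions_bounded:
  fixes G :: "nat \<Rightarrow> 'v \<Rightarrow> ereal"
  assumes F: "proper_fun F" and u: "u \<in> domF F"
    and G: "\<And>n. proper_fun (G n)" and x: "\<And>n. hvi_solution A \<gamma> J (G n) (x n)"
    and w: "w \<longlonglongrightarrow> u" and Gw: "(\<lambda>n. G n (w n)) \<longlonglongrightarrow> F u"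
    and d: "d \<ge> 0" "\<And>n v. ereal (- d * (1 + norm v)) \<le> G n v"
  shows "bounded (range x)"
proof -
  obtain C where C: "C \<ge> 0" "\<forall>\<^sub>F n in sequentially. \<forall>v. - C * norm (v - w n) \<le> \<Phi> (w n) v"
    using \<Phi>_bounded_below[OF w] by blast
  have wD: "\<forall>\<^sub>F n in sequentially. w n \<in> domF (G n)"
    using order_tendstoD(2)[OF Gw, of \<infinity>] u by (simp add: domF_def)
  define B where
    "B n = norm (w n) + (1 + ((C + d) + (d * (1 + norm (w n)) + \<bar>fin_val (G n) (w n)\<bar>)) / gap)" for n
  have "(\<lambda>n. fin_val (G n) (w n)) \<longlonglongrightarrow> fin_val F u"
    unfolding fin_val_def[of "G _"]
    by (rule lim_real_of_ereal) (use Gw fin_val[OF F u] in simp)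
  then have "B \<longlonglongrightarrow> norm u + (1 + ((C + d) + (d * (1 + norm u) + \<bar>fin_val F u\<bar>)) / gap)"
    unfolding B_def by (intro tendsto_intros w) (use gap_pos in auto)
  then have "bounded (range B)" by (rule convergent_imp_bounded)
  then obtain K where K: "\<forall>n. \<bar>B n\<bar> \<le> K" unfolding bounded_iff by auto
  from C(2) wD have "\<forall>\<^sub>F n in sequentially. norm (x n) \<le> K"
  proof eventually_elim
    case (elim n)
    have "norm (x n - w n) \<le> 1 + ((C + d) + (d * (1 + norm (w n)) + \<bar>fin_val (G n) (w n)\<bar>)) / gap"
      by (rule hvi_solution_bound[OF G x _ C(1) _ d]) (use elim in auto)
    moreover have "norm (x n) \<le> norm (w n) + norm (x n - w n)"
      using norm_triangle_ineq[of "w n" "x n - w n"] by simp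
    ultimately have "norm (x n) \<le> B n" by (simp add: B_def)
    then show ?case using K[rule_format, of n] by simp
  qed
  then obtain N where N: "\<forall>n\<ge>N. norm (x n) \<le> K" unfolding eventually_sequentially by blast
  have "x n \<in> x ` {..<N} \<union> cball 0 K" for n
    using N by (cases "n < N") auto
  then have "range x \<subseteq> x ` {..<N} \<union> cball 0 K" by blast
  then show ?thesis
    by (rule bounded_subset[rotated]) (simp add: finite_imp_bounded)
qed

text \<open>The core of the stability result.  The weak limit \<open>y\<close> is not shown to be a solution first; it is
  compared directly with the known solution \<open>u\<close>, which keeps the terms with \<open>J\<^sup>0\<close> in the form
  to which relaxed monotonicity applies.\<close>

lemma hvi_solutions_weak_limit:
  fixes G :: "nat \<Rightarrow> 'v \<Rightarrow> ereal"
  assumes F: "proper_fun F" and u: "hvi_solution A \<gamma> J F u"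
    and G: "\<And>n. proper_fun (G n)" and x: "\<And>n. hvi_solution A \<gamma> J (G n) (x n)"
    and w: "w \<longlonglongrightarrow> u" and Gw: "(\<lambda>n. G n (w n)) \<longlonglongrightarrow> F u"
    and bdd: "bounded (range x)" and weak: "weakly_converges x y"
    and \<gamma>x: "(\<lambda>n. blinfun_apply \<gamma> (x n)) \<longlonglongrightarrow> blinfun_apply \<gamma> y"
    and liminf: "F y \<le> liminf (\<lambda>n. G n (x n))"
  shows "x \<longlonglongrightarrow> u"
proof -
  obtain K where K: "\<And>n. norm (x n) \<le> K" using bdd unfolding bounded_iff by blast
  have uD: "u \<in> domF F" and usol: "\<And>v. v \<in> domF F \<Longrightarrow> fin_val F u \<le> \<Phi> u v + fin_val F v"
    using u unfolding hvi_solution_iff[OF F] by auto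
  have xD: "x n \<in> domF (G n)"
    and xsol: "\<And>v. v \<in> domF (G n) \<Longrightarrow> fin_val (G n) (x n) \<le> \<Phi> (x n) v + fin_val (G n) v" for n
    using x[of n] unfolding hvi_solution_iff[OF G] by auto
  define g where "g n = fin_val (G n) (x n)" for n
  have Gx: "G n (x n) = ereal (g n)" for n using fin_val[OF G xD] by (simp add: g_def)
  define j where "j n = clarke J (blinfun_apply \<gamma> (x n)) (blinfun_apply \<gamma> (w n - x n))" for n
  define W where "W n = fin_val (G n) (w n)" for n
  define R where "R n = blinfun_apply (A (w n)) (w n - x n) + j n + W n" for n
  define jy where "jy = clarke J (blinfun_apply \<gamma> y) (blinfun_apply \<gamma> (u - y))"
  define Ry where "Ry = blinfun_apply (A u) (u - y) + jy + fin_val F u"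
  have wD: "\<forall>\<^sub>F n in sequentially. w n \<in> domF (G n)"
    using order_tendstoD(2)[OF Gw, of \<infinity>] uD by (simp add: domF_def)
  have lower: "\<forall>\<^sub>F n in sequentially. g n + cA * (norm (x n - w n))\<^sup>2 \<le> R n"
    using wD
  proof eventually_elim
    case (elim n)
    have "blinfun_apply (A (x n)) (w n - x n) = - blinfun_apply (A (x n)) (x n - w n)"
      "blinfun_apply (A (w n)) (w n - x n) = - blinfun_apply (A (w n)) (x n - w n)"
      by (simp_all add: blinfun.diff_right)
    then show ?case
      using xsol[OF elim] A_strongly_monotone[of "x n" "w n"] by (simp add: g_def R_def W_def j_def \<Phi>_def)
  qed
  have Wlim: "W \<longlonglongrightarrow> fin_val F u"
    unfolding W_def fin_val_def[of "G _"]
    by (rule lim_real_of_ereal) (use Gw fin_val[OF F uD] in simp)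
  have Alim: "(\<lambda>n. blinfun_apply (A (w n)) (w n - x n)) \<longlonglongrightarrow> blinfun_apply (A u) (u - y)"
  proof -
    have "(\<lambda>n. blinfun_apply (A (w n) - A u) (x n)) \<longlonglongrightarrow> 0"
    proof (rule Lim_null_comparison)
      show "\<forall>\<^sub>F n in sequentially. norm (blinfun_apply (A (w n) - A u) (x n)) \<le> norm (A (w n) - A u) * K"
        by (intro always_eventually allI order_trans[OF norm_blinfun] mult_left_mono K) auto
      have "(\<lambda>n. norm (A (w n) - A u)) \<longlonglongrightarrow> 0"
        using A_tendsto[OF w] by (simp add: LIM_zero tendsto_norm_zero)
      then show "(\<lambda>n. norm (A (w n) - A u) * K) \<longlonglongrightarrow> 0" by (rule tendsto_mult_left_zero)
    qed
    moreover have "(\<lambda>n. blinfun_apply (A u) (x n)) \<longlonglongrightarrow> blinfun_apply (A u) y"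
      using weak unfolding weakly_converges_def by blast
    moreover have "(\<lambda>n. blinfun_apply (A (w n)) (w n)) \<longlonglongrightarrow> blinfun_apply (A u) u"
      by (intro tendsto_intros A_tendsto w)
    ultimately have "(\<lambda>n. blinfun_apply (A (w n)) (w n)
        - (blinfun_apply (A (w n) - A u) (x n) + blinfun_apply (A u) (x n)))
        \<longlonglongrightarrow> blinfun_apply (A u) u - (0 + blinfun_apply (A u) y)"
      by (intro tendsto_diff tendsto_add)
    then show ?thesis by (simp add: blinfun.diff_left blinfun.diff_right)
  qed
  have upper: "\<forall>\<^sub>F n in sequentially. R n < Ry + e" if e: "e > 0" for e
  proof -
    have "\<forall>\<^sub>F n in sequentially. blinfun_apply (A (w n)) (w n - x n) < blinfun_apply (A u) (u - y) + e / 3"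
      using e by (intro order_tendstoD(2)[OF Alim]) simp
    moreover have "\<forall>\<^sub>F n in sequentially. W n < fin_val F u + e / 3"
      using e by (intro order_tendstoD(2)[OF Wlim]) simp
    moreover have "(\<lambda>n. blinfun_apply \<gamma> (w n - x n)) \<longlonglongrightarrow> blinfun_apply \<gamma> (u - y)"
      unfolding blinfun.diff_right by (intro tendsto_intros \<gamma>x w)
    then have "\<forall>\<^sub>F n in sequentially. j n < jy + e / 3"
      unfolding j_def
    proof (rule clarke_upper_semicontinuous[OF J_lip \<gamma>x])
      show "clarke J (blinfun_apply \<gamma> y) (blinfun_apply \<gamma> (u - y)) < jy + e / 3"
        using e unfolding jy_def by linarith
    qed
    ultimately show ?thesis
      by eventually_elim (simp add: R_def Ry_def)
  qed
  have cA: "cA > 0" using small cJ_pos by (smt (verit) mult_nonneg_nonneg zero_le_power2)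
  have yD: "y \<in> domF F"
  proof -
    have "\<forall>\<^sub>F n in sequentially. G n (x n) \<le> ereal (Ry + 1)"
      using lower upper[OF zero_less_one]
    proof eventually_elim
      case (elim n)
      have "0 \<le> cA * (norm (x n - w n))\<^sup>2" using cA by simp
      then show ?case using elim by (simp add: Gx)
    qed
    then have "liminf (\<lambda>n. G n (x n)) \<le> ereal (Ry + 1)" by (intro Liminf_le) auto
    with liminf have "F y \<le> ereal (Ry + 1)" by (rule order_trans)
    then show ?thesis by (auto simp: domF_def)
  qed
  \<comment> \<open>the relaxed monotonicity defect between \<open>u\<close> and
    \<open>y\<close>\<close>
  define q where "q = cJ * (norm \<gamma>)\<^sup>2 * (norm (u - y))\<^sup>2"
  have Ry: "Ry \<le> fin_val F y + q"
  proof -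
    have "blinfun_apply (A u) (y - u) = - blinfun_apply (A u) (u - y)" by (simp add: blinfun.diff_right)
    then show ?thesis using usol[OF yD] clarke_relaxed[of u y]
      by (simp add: Ry_def jy_def q_def \<Phi>_def)
  qed
  have main: "\<forall>\<^sub>F n in sequentially. cA * (norm (x n - w n))\<^sup>2 \<le> q + e" if e: "e > 0" for e
  proof -
    have "ereal (fin_val F y - e / 2) < F y"
      unfolding fin_val[OF F yD] using e by simp
    also note liminf
    finally have "ereal (fin_val F y - e / 2) < liminf (\<lambda>n. G n (x n))" .
    from less_LiminfD[OF this] have "\<forall>\<^sub>F n in sequentially. fin_val F y - e / 2 < g n"
      by (simp add: Gx)
    with lower upper[OF half_gt_zero[OF e]] show ?thesis
      by eventually_elim (use Ry in linarith)
  qed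
  have "y = u"
  proof -
    \<comment> \<open>weak lower semicontinuity of the norm: \<open>f\<close> norms \<open>y -
      u\<close> and \<open>f (x n - w n)\<close> converges\<close>
    obtain f :: "'v \<Rightarrow>\<^sub>L real" where f: "\<And>z. \<bar>blinfun_apply f z\<bar> \<le> norm z"
      "blinfun_apply f (y - u) = norm (y - u)"
      using norming_functional[of "y - u"] by metis
    have "(\<lambda>n. blinfun_apply f (x n)) \<longlonglongrightarrow> blinfun_apply f y"
      using weak unfolding weakly_converges_def by blast
    then have "(\<lambda>n. blinfun_apply f (x n) - blinfun_apply f (w n)) \<longlonglongrightarrow> blinfun_apply f y - blinfun_apply f u"
      by (rule tendsto_diff) (intro tendsto_intros w)
    then have "(\<lambda>n. cA * (blinfun_apply f (x n - w n))\<^sup>2) \<longlonglongrightarrow> cA * (norm (y - u))\<^sup>2"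
      unfolding f(2)[symmetric] blinfun.diff_right by (intro tendsto_mult tendsto_power tendsto_const)
    moreover have "\<forall>\<^sub>F n in sequentially. cA * (blinfun_apply f (x n - w n))\<^sup>2 \<le> q + e" if "e > 0" for e
      using main[OF that]
    proof eventually_elim
      case (elim n)
      have "cA * (blinfun_apply f (x n - w n))\<^sup>2 \<le> cA * (norm (x n - w n))\<^sup>2"
        using f(1)[of "x n - w n"] cA by (intro mult_left_mono) (auto simp: abs_le_square_iff[symmetric])
      then show ?case using elim by simp
    qed
    ultimately have "cA * (norm (y - u))\<^sup>2 \<le> q + e" if "e > 0" for e
      using that by (intro tendsto_upperbound) auto
    then have "cA * (norm (y - u))\<^sup>2 \<le> q" by (rule field_le_epsilon)
    then have "gap * (norm (y - u))\<^sup>2 \<le> 0"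
      by (simp add: gap_def q_def norm_minus_commute left_diff_distrib)
    then show ?thesis using gap_pos by (simp add: mult_le_0_iff)
  qed
  then have q0: "q = 0" by (simp add: q_def)
  have "(\<lambda>n. x n - w n) \<longlonglongrightarrow> 0"
  proof (rule tendstoI)
    fix r :: real assume r: "r > 0"
    then have "0 < cA * r\<^sup>2 / 2" using cA by simp
    from main[OF this] show "\<forall>\<^sub>F n in sequentially. dist (x n - w n) 0 < r"
    proof eventually_elim
      case (elim n)
      then have "cA * (norm (x n - w n))\<^sup>2 < cA * r\<^sup>2"
        using q0 r cA mult_pos_pos[OF cA zero_less_power[OF r, of 2]] by linarith
      then have "(norm (x n - w n))\<^sup>2 < r\<^sup>2" using cA by simp
      then have "norm (x n - w n) < r" by (rule power_less_imp_less_base) (use r in simp)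
      then show ?case by simp
    qed
  qed
  from tendsto_add[OF this w] show ?thesis by simp
qed

end

section \<open>Mosco convergence\<close>

text \<open>Compactness provides a limit of a subsequence of the images; weak convergence identifies it,
  because functionals separate points.\<close>

lemma compact_operator_weakly_convergent:
  fixes T :: "'v::real_normed_vector \<Rightarrow>\<^sub>L 'x::real_normed_vector"
  assumes T: "compact_operator T" and bdd: "bounded (range x)" and weak: "weakly_converges x y"
  obtains r where "strict_mono r" "(\<lambda>n. blinfun_apply T (x (r n))) \<longlonglongrightarrow> blinfun_apply T y"
proof -
  have "seq_compact (closure (blinfun_apply T ` range x))"
    using T bdd unfolding compact_operator_def by (simp add: compact_eq_seq_compact_metric)
  moreover have "\<forall>n. blinfun_apply T (x n) \<in> closure (blinfun_apply T ` range x)"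
    using closure_subset[of "blinfun_apply T ` range x"] by auto
  ultimately obtain l r where r: "strict_mono r" "((\<lambda>n. blinfun_apply T (x n)) \<circ> r) \<longlonglongrightarrow> l"
    using seq_compactE by metis
  obtain f :: "'x \<Rightarrow>\<^sub>L real" where f: "blinfun_apply f (l - blinfun_apply T y) = norm (l - blinfun_apply T y)"
    using norming_functional[of "l - blinfun_apply T y"] by metis
  have "(\<lambda>n. blinfun_apply f (blinfun_apply T (x (r n)))) \<longlonglongrightarrow> blinfun_apply f l"
    using r(2) by (intro tendsto_intros) (simp add: o_def)
  moreover have "(\<lambda>n. blinfun_apply (f o\<^sub>L T) (x n)) \<longlonglongrightarrow> blinfun_apply (f o\<^sub>L T) y"
    using weak unfolding weakly_converges_def by blast
  from LIMSEQ_subseq_LIMSEQ[OF this r(1)]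
  have "(\<lambda>n. blinfun_apply f (blinfun_apply T (x (r n)))) \<longlonglongrightarrow> blinfun_apply f (blinfun_apply T y)"
    by (simp add: o_def)
  ultimately have "blinfun_apply f l = blinfun_apply f (blinfun_apply T y)" by (rule LIMSEQ_unique)
  then have "l = blinfun_apply T y" using f by (simp add: blinfun.diff_right)
  then show thesis using that[OF r(1)] r(2) by (simp add: o_def)
qed

lemma weakly_converges_subseq:
  "weakly_converges x y \<Longrightarrow> strict_mono r \<Longrightarrow> weakly_converges (x \<circ> r) y"
  unfolding weakly_converges_def using LIMSEQ_subseq_LIMSEQ by (fastforce simp: o_def)

text \<open>The lower bound in Mosco convergence speaks of full sequences, so a sequence indexed by the
  range of \<open>r\<close> is filled up with its weak limit.\<close>

lemma mosco_liminf_subseq: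
  assumes M: "mosco_converges Fs F" and r: "strict_mono r" and weak: "weakly_converges x y"
  shows "F y \<le> liminf (\<lambda>n. Fs (r n) (x n))"
proof -
  define z where "z n = (if n \<in> range r then x (inv r n) else y)" for n
  have zr: "z (r n) = x n" for n
    using strict_mono_imp_inj_on[OF r] by (simp add: z_def)
  have "weakly_converges z y"
    unfolding weakly_converges_def
  proof (intro allI tendstoI)
    fix f :: "'a \<Rightarrow>\<^sub>L real" and e :: real assume e: "e > 0"
    have "(\<lambda>n. blinfun_apply f (x n)) \<longlonglongrightarrow> blinfun_apply f y"
      using weak unfolding weakly_converges_def by blast
    from tendstoD[OF this e] obtain N where N: "\<And>n. n \<ge> N \<Longrightarrow> dist (blinfun_apply f (x n)) (blinfun_apply f y) < e"
      unfolding eventually_sequentially by blast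
    have "dist (blinfun_apply f (z m)) (blinfun_apply f y) < e" if m: "m \<ge> r N" for m
    proof (cases "m \<in> range r")
      case True
      then obtain n where n: "m = r n" by blast
      then have "n \<ge> N" using m strict_mono_less_eq[OF r] by simp
      then show ?thesis using N n zr by simp
    next
      case False
      then show ?thesis using e by (simp add: z_def)
    qed
    then show "\<forall>\<^sub>F m in sequentially. dist (blinfun_apply f (z m)) (blinfun_apply f y) < e"
      unfolding eventually_sequentially by blast
  qed
  then have "F y \<le> liminf (\<lambda>n. Fs n (z n))"
    using M unfolding mosco_converges_def by blast
  also have "\<dots> \<le> liminf ((\<lambda>n. Fs n (z n)) \<circ> r)" by (rule liminf_subseq_mono[OF r])
  finally show ?thesis by (simp add: o_def zr)
qed

text \<open>Supplies the lower bound on \<open>F\<close> that the existence proof needs, by passing to the limit along a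
  recovery sequence.\<close>

lemma mosco_limit_minorant:
  assumes M: "mosco_converges Fs F" and Fd: "\<And>n v. ereal (- d * (1 + norm v)) \<le> Fs n v"
  shows "ereal (- d * (1 + norm v)) \<le> F v"
proof -
  obtain x where x: "x \<longlonglongrightarrow> v" "(\<lambda>n. Fs n (x n)) \<longlonglongrightarrow> F v"
    using M unfolding mosco_converges_def by blast
  have "(\<lambda>n. ereal (- d * (1 + norm (x n)))) \<longlonglongrightarrow> ereal (- d * (1 + norm v))"
    by (intro tendsto_intros x)
  then show ?thesis
    by (rule tendsto_le[OF sequentially_bot x(2)]) (intro always_eventually allI Fd)
qed

text \<open>If the solutions did not converge to \<open>u\<close>, a subsequence would stay away from \<open>u\<close>; a further
  subsequence converges weakly with convergent images under \<open>\<gamma>\<close>, and thus strongly to \<open>u\<close>.\<close>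

theorem theorem5:
  fixes A :: "'v::banach \<Rightarrow> 'v \<Rightarrow>\<^sub>L real"
    and \<gamma> :: "'v \<Rightarrow>\<^sub>L 'x::{real_inner, complete_space}"
    and J :: "'x \<Rightarrow> real"
    and c\<^sub>A c\<^sub>J d\<^sub>J d\<^sub>0 :: real
    and F :: "'v \<Rightarrow> ereal"
    and Fs :: "nat \<Rightarrow> 'v \<Rightarrow> ereal"
  assumes "reflexive_space TYPE('v)"
    and "compact_operator \<gamma>"
    and "locally_lipschitz J"
    and "continuous_on UNIV A"
    and "c\<^sub>A > 0"
    and "strongly_monotone c\<^sub>A A"
    and "c\<^sub>J > 0"
    and "\<And>y\<^sub>1 y\<^sub>2. gen_dir_deriv J y\<^sub>1 (y\<^sub>2 - y\<^sub>1) + gen_dir_deriv J y\<^sub>2 (y\<^sub>1 - y\<^sub>2)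
                  \<le> ereal (c\<^sub>J * (norm (y\<^sub>1 - y\<^sub>2))\<^sup>2)"
    and "d\<^sub>J > 0"
    and "\<And>z \<zeta>. \<zeta> \<in> gen_gradient J z \<Longrightarrow> norm \<zeta> \<le> d\<^sub>J * (1 + norm z)"
    and "c\<^sub>J * (norm \<gamma>)\<^sup>2 < c\<^sub>A"
    and "convex_fun F" and "lsc_fun F" and "proper_fun F"
    and "\<And>n. convex_fun (Fs n)" and "\<And>n. lsc_fun (Fs n)" and "\<And>n. proper_fun (Fs n)"
    and "d\<^sub>0 \<ge> 0"
    and "\<And>n v. Fs n v \<ge> ereal (- d\<^sub>0 * (1 + norm v))"
    and "mosco_converges Fs F"
  shows "(\<lambda>n. hvi_sol A \<gamma> J (Fs n)) \<longlonglongrightarrow> hvi_sol A \<gamma> J F"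
proof -
  note refl = assms(1) and compact = assms(2) and Fs_proper = assms(17) and d0 = assms(18)
    and minorant = assms(19) and mosco = assms(20)
  interpret hemivariational_inequality A \<gamma> J c\<^sub>A c\<^sub>J
    by unfold_locales (use assms in auto)
  define x where "x n = hvi_sol A \<gamma> J (Fs n)" for n
  define u where "u = hvi_sol A \<gamma> J F"
  have x: "hvi_solution A \<gamma> J (Fs n) (x n)" for n
    unfolding x_def by (rule hvi_sol_solution[OF refl assms(15,16,17) minorant])
  have u: "hvi_solution A \<gamma> J F u"
    unfolding u_def by (rule hvi_sol_solution[OF refl assms(12-14) mosco_limit_minorant[OF mosco minorant]])
  have uD: "u \<in> domF F" using u by (simp add: hvi_solution_def)
  from mosco have "\<exists>w. w \<longlonglongrightarrow> u \<and> (\<lambda>n. Fs n (w n)) \<longlonglongrightarrow> F u"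
    unfolding mosco_converges_def by simp
  then obtain w where w: "w \<longlonglongrightarrow> u" "(\<lambda>n. Fs n (w n)) \<longlonglongrightarrow> F u" by blast
  have bdd: "bounded (range x)"
    by (rule hvi_solutions_bounded[OF assms(14) uD Fs_proper x w d0 minorant])
  have "x \<longlonglongrightarrow> u"
  proof (rule ccontr)
    assume "\<not> x \<longlonglongrightarrow> u"
    then obtain e where e: "e > 0" "\<exists>\<^sub>F n in sequentially. e \<le> dist (x n) u"
      unfolding tendsto_iff by (auto simp: not_eventually not_less)
    from e(2) have "infinite {n. e \<le> dist (x n) u}"
      by (simp add: frequently_cofinite[symmetric] cofinite_eq_sequentially)
    from infinite_enumerate[OF this] obtain s :: "nat \<Rightarrow> nat"
      where s: "strict_mono s" "\<forall>k. e \<le> dist (x (s k)) u" by auto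
    have bs: "bounded (range (x \<circ> r))" for r :: "nat \<Rightarrow> nat"
      by (rule bounded_subset[OF bdd]) auto
    obtain p y where p: "strict_mono p" "weakly_converges ((x \<circ> s) \<circ> p) y"
      using bounded_imp_weakly_convergent_subsequence[OF refl bs[of s]] by metis
    obtain q where q: "strict_mono q"
      "(\<lambda>n. blinfun_apply \<gamma> (((x \<circ> s) \<circ> p) (q n))) \<longlonglongrightarrow> blinfun_apply \<gamma> y"
      using compact_operator_weakly_convergent[OF compact _ p(2)] bs[of "s \<circ> p"]
      by (metis comp_assoc)
    define r where "r = s \<circ> p \<circ> q"
    have r: "strict_mono r" unfolding r_def by (intro strict_mono_o s p q)
    have weak: "weakly_converges (\<lambda>n. x (r n)) y"
      using weakly_converges_subseq[OF p(2) q(1)] by (simp add: r_def o_def)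
    have "(\<lambda>n. x (r n)) \<longlonglongrightarrow> u"
    proof (rule hvi_solutions_weak_limit[OF assms(14) u Fs_proper x _ _ _ weak])
      show "(\<lambda>n. w (r n)) \<longlonglongrightarrow> u"
        using LIMSEQ_subseq_LIMSEQ[OF w(1) r] by (simp add: o_def)
      show "(\<lambda>n. Fs (r n) (w (r n))) \<longlonglongrightarrow> F u"
        using LIMSEQ_subseq_LIMSEQ[OF w(2) r] by (simp add: o_def)
      show "bounded (range (\<lambda>n. x (r n)))" using bs[of r] by (simp add: o_def)
      show "(\<lambda>n. blinfun_apply \<gamma> (x (r n))) \<longlonglongrightarrow> blinfun_apply \<gamma> y"
        using q(2) by (simp add: r_def)
      show "F y \<le> liminf (\<lambda>n. Fs (r n) (x (r n)))"
        by (rule mosco_liminf_subseq[OF mosco r weak])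
    qed
    from eventually_happens'[OF sequentially_bot tendstoD[OF this e(1)]]
    obtain n where "dist (x (r n)) u < e" by auto
    then show False using s(2) by (auto simp: r_def not_le[symmetric])
  qed
  then show ?thesis by (simp add: x_def[abs_def] u_def)
qed

end
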